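(* Let $d\ge 1$. For any $d$-dimensional SIC ensemble $\mathcal{E}=\{\rho_x\}$ and any $d$-dimensional SIC POVM $\mathcal{P}=\{\Pi_y\}$, the accessible information $A(\mathcal{E})$ and the informational power $W(\mathcal{P})$ satisfy $$\log d-\frac{1}{\ln 2}\sum_{n=2}^{d}\frac1n\;\le\; A(\mathcal{E})\;\le\;\log\frac{2d}{d+1}$$ and $$\log d-\frac{1}{\ln 2}\sum_{n=2}^{d}\frac1n\;\le\; W(\mathcal{P})\;\le\;\log\frac{2d}{d+1}.$$
   Context: $\log$ is the base-2 logarithm, $\ln$ the natural logarithm. All Hilbert spaces are finite-dimensional and complex. A state is a positive semidefinite operator $\rho$ with $\operatorname{Tr}\rho\le 1$. A discrete ensemble is a family $\mathcal{E}=\{\rho_x\}$ of states indexed by a countable set of real numbers with $\sum_x\operatorname{Tr}[\rho_x]=1$; a continuous ensemble is a measurable operator-valued function $x\mapsto\rho_x$, from a measurable set of real numbers to states, with $\int dx\,\operatorname{Tr}[\rho_x]=1$. Its average state is $\rho=\sum_x\rho_x$ (resp. $\int dx\,\rho_x$). An effect is an operator $\Pi$ with $0\le\Pi\le \mathbb{1}$. A discrete POVM is a family $\mathcal{P}=\{\Pi_y\}$ of effects indexed by a countable set of real numbers with $\sum_y\Pi_y=\mathbb{1}$; a continuous POVM is a measurable function $y\mapsto\Pi_y$, from a measurable set of real numbers to effects, with $\int dy\,\Pi_y=\mathbb{1}$. Given $\mathcal{E}$ and $\mathcal{P}$ on the same space, the joint distribution (density) of random variables $X,Y$ is $p(x,y)=\operatorname{Tr}[\rho_x\Pi_y]$,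 with marginals $p(x)=\operatorname{Tr}[\rho_x]$ and $p(y)=\operatorname{Tr}[\rho\,\Pi_y]$. The mutual information is $$I(\mathcal{E},\mathcal{P})=I(X;Y)=\sum_{x,y}p(x,y)\log\frac{p(x,y)}{p(x)p(y)},$$ with sums replaced by integrals for continuous indices (terms with $p(x,y)=0$ count as $0$); it equals $H(X)+H(Y)-H(X,Y)$ whenever these (Shannon or differential) entropies are well defined and finite. Accessible information: $A(\mathcal{E})=\sup_{\mathcal{P}}I(\mathcal{E},\mathcal{P})$ over all discrete or continuous POVMs on the space. Informational power: $W(\mathcal{P})=\sup_{\mathcal{E}}I(\mathcal{E},\mathcal{P})$ over all discrete or continuous ensembles on the space. A $d$-dimensional SIC (symmetric informationally complete) set of operators is a family $\{X_x\}_{x=1}^{d^2}$ of $d^2$ rank-one positive semidefinite operators on a $d$-dimensional Hilbert space such that, for some $\lambda$, $\operatorname{Tr}[X_x]=\lambda$ for all $x$ and $\operatorname{Tr}[X_xX_y]=\frac{\lambda^2}{d+1}$ for all $x\ne y$. (Then automatically $\sum_xX_x=d\lambda\mathbb{1}$.) A SIC ensemble is a SIC set with $\lambda=\frac1{d^2}$; a SIC POVM is a SIC set with $\lambda=\frac1d$. *)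

theory Defs
  imports "HOL-Analysis.Analysis"
begin

text \<open>
  Operators on a \<open>d\<close>-dimensional complex Hilbert space are matrices over a finite index type
  with \<open>d = CARD('d)\<close>.
\<close>

definition psd :: "complex^'d^'d \<Rightarrow> bool" where
  "psd A \<longleftrightarrow> (\<forall>v :: complex^'d. (\<Sum>i\<in>UNIV. cnj (v $ i) * (A *v v) $ i) \<in> \<real> \<and>
                                 0 \<le> Re (\<Sum>i\<in>UNIV. cnj (v $ i) * (A *v v) $ i))"

definition is_state :: "complex^'d^'d \<Rightarrow> bool" where
  "is_state \<rho> \<longleftrightarrow> psd \<rho> \<and> Re (trace \<rho>) \<le> 1"

definition is_effect :: "complex^'d^'d \<Rightarrow> bool" where
  "is_effect P \<longleftrightarrow> psd P \<and> psd (mat 1 - P)"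

text \<open>
  Discrete and continuous families are treated together by recording the measure on the index
  set: counting measure on a countable set of reals (integrals are sums, and measurability is
  automatic), or Lebesgue measure on a measurable set of reals. Only the values of a family on
  the space of this measure are relevant.
\<close>

definition index_measure :: "real measure \<Rightarrow> bool" where
  "index_measure \<mu> \<longleftrightarrow> (\<exists>S. countable S \<and> \<mu> = count_space S) \<or>
                       (\<exists>S \<in> sets lebesgue. \<mu> = lebesgue_on S)"

definition is_ensemble :: "real measure \<Rightarrow> (real \<Rightarrow> complex^'d^'d) \<Rightarrow> bool" where
  "is_ensemble \<mu> \<rho> \<longleftrightarrow> index_measure \<mu> \<and> \<rho> \<in> borel_measurable \<mu> \<and>
     (\<forall>x \<in> space \<mu>. is_state (\<rho> x)) \<and>
     has_bochner_integral \<mu> (\<lambda>x. Re (trace (\<rho> x))) 1"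

definition is_povm :: "real measure \<Rightarrow> (real \<Rightarrow> complex^'d^'d) \<Rightarrow> bool" where
  "is_povm \<nu> P \<longleftrightarrow> index_measure \<nu> \<and> P \<in> borel_measurable \<nu> \<and>
     (\<forall>y \<in> space \<nu>. is_effect (P y)) \<and>
     has_bochner_integral \<nu> P (mat 1)"

definition average_state :: "real measure \<Rightarrow> (real \<Rightarrow> complex^'d^'d) \<Rightarrow> complex^'d^'d" where
  "average_state \<mu> \<rho> = (\<integral>x. \<rho> x \<partial>\<mu>)"

definition p_joint :: "(real \<Rightarrow> complex^'d^'d) \<Rightarrow> (real \<Rightarrow> complex^'d^'d) \<Rightarrow> real \<Rightarrow> real \<Rightarrow> real" where
  "p_joint \<rho> P x y = Re (trace (\<rho> x ** P y))"

definition p_input :: "(real \<Rightarrow> complex^'d^'d) \<Rightarrow> real \<Rightarrow> real" where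
  "p_input \<rho> x = Re (trace (\<rho> x))"

definition p_outcome ::
  "real measure \<Rightarrow> (real \<Rightarrow> complex^'d^'d) \<Rightarrow> (real \<Rightarrow> complex^'d^'d) \<Rightarrow> real \<Rightarrow> real" where
  "p_outcome \<mu> \<rho> P y = Re (trace (average_state \<mu> \<rho> ** P y))"

text \<open>
  For an ensemble and a POVM the integrand below is always integrable: its negative part because
  \<open>q \<cdot> log (r / q) \<le> r / ln 2\<close>, its positive part because \<open>p(x,y) \<le> p(x) Tr P\<^sub>y\<close> and, by Jensen,
  \<open>\<integral> p(y) log (Tr P\<^sub>y / p(y)) dy \<le> log d\<close>. So the value 0 that the Bochner integral gives to
  non-integrable functions does not occur. Where \<open>p(x,y) = 0\<close> the integrand is 0.
\<close>

definition mutual_info ::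
  "real measure \<Rightarrow> (real \<Rightarrow> complex^'d^'d) \<Rightarrow> real measure \<Rightarrow> (real \<Rightarrow> complex^'d^'d) \<Rightarrow> real" where
  "mutual_info \<mu> \<rho> \<nu> P =
     (\<integral>(x, y). p_joint \<rho> P x y *
        log 2 (p_joint \<rho> P x y / (p_input \<rho> x * p_outcome \<mu> \<rho> P y)) \<partial>(\<mu> \<Otimes>\<^sub>M \<nu>))"

text \<open>The suprema are taken in \<^typ>\<open>ereal\<close>, so that they are meaningful without a boundedness proof.\<close>

definition accessible_information :: "real measure \<Rightarrow> (real \<Rightarrow> complex^'d^'d) \<Rightarrow> ereal" where
  "accessible_information \<mu> \<rho> =
     (SUP (\<nu>, P) \<in> {(\<nu>, P). is_povm \<nu> P}. ereal (mutual_info \<mu> \<rho> \<nu> P))"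

definition informational_power :: "real measure \<Rightarrow> (real \<Rightarrow> complex^'d^'d) \<Rightarrow> ereal" where
  "informational_power \<nu> P =
     (SUP (\<mu>, \<rho>) \<in> {(\<mu>, \<rho>). is_ensemble \<mu> \<rho>}. ereal (mutual_info \<mu> \<rho> \<nu> P))"

definition sic_index :: "nat \<Rightarrow> real set" where
  "sic_index d = real ` {1..d^2}"

definition is_sic_set :: "real \<Rightarrow> (real \<Rightarrow> complex^'d^'d) \<Rightarrow> bool" where
  "is_sic_set l X \<longleftrightarrow>
     (\<forall>x \<in> sic_index CARD('d). psd (X x) \<and> rank (X x) = 1 \<and> trace (X x) = of_real l) \<and>
     (\<forall>x \<in> sic_index CARD('d). \<forall>y \<in> sic_index CARD('d). x \<noteq> y \<longrightarrow>
        trace (X x ** X y) = of_real (l^2 / (real CARD('d) + 1)))"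

definition is_sic_ensemble :: "(real \<Rightarrow> complex^'d^'d) \<Rightarrow> bool" where
  "is_sic_ensemble \<rho> \<longleftrightarrow> is_sic_set (1 / (real CARD('d))^2) \<rho>"

definition is_sic_povm :: "(real \<Rightarrow> complex^'d^'d) \<Rightarrow> bool" where
  "is_sic_povm P \<longleftrightarrow> is_sic_set (1 / real CARD('d)) P"

end

theory Submission
  imports Defs "HOL-Probability.Distributions" "HOL-Real_Asymp.Real_Asymp"
begin

text \<open>
  Upper bounds: a SIC set spans an equiangular frame of the real inner product space of Hermitian
  matrices, so for a positive semidefinite \<open>A\<close> the probabilities \<open>p\<^sub>x\<close> proportional to \<open>Tr (X\<^sub>x A)\<close> have
  index of coincidence \<open>\<Sum> p\<^sub>x\<^sup>2 \<le> 2 / (d (d + 1))\<close>. By concavity of the logarithm this bounds the mutual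
  information with an alphabet of size \<open>d\<^sup>2\<close> by \<open>log (d\<^sup>2 \<cdot> 2 / (d (d + 1)))\<close>.

  Lower bounds: for a complex Gaussian vector \<open>z\<close> the operators \<open>|z\<rangle>\<langle>z|\<close> average to the identity, and the
  law of \<open>\<langle>v, z\<rangle>\<close> is the same for every unit vector \<open>v\<close>. The information between them and the SIC set is
  therefore the explicit number \<open>ln d + \<Gamma>'(2) / \<Gamma>(2) - \<Gamma>'(d + 1) / \<Gamma>(d + 1)\<close>, which is the lower bound. As the
  Gaussian operators are not indexed by reals, they are integrated over finitely many small cells;
  this yields finite POVMs (and, after division by \<open>d\<close>, finite ensembles) losing arbitrarily little.
\<close>

section \<open>Positive semidefinite matrices\<close>

text \<open>In both problems one side of the joint distribution has the alphabet of
  \<open>d^2\<close> SIC letters and the other side is arbitrary, so one inequality and one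
  construction serve both, up to exchanging input and output. Nothing is known about the SIC vectors
  beyond their overlaps. A good measurement therefore has to treat all unit vectors alike, which
  leads to random vectors. Gaussian vectors are preferred to uniform ones on the sphere because
  their density is explicit and their projections are again Gaussian. The price is the random
  length: normalising the likelihood by \<open>(norm z)^2\<close>, the trace of the operator,
  subtracts an expectation of \<open>ln ((norm z)^2)\<close>, and this is where the harmonic sum
  comes from. The constant \<open>\<Gamma>'(2)\<close>, which is 1 minus Euler's constant, cancels
  and stays symbolic. The resulting value is the subentropy of the maximally mixed state.\<close>

definition qform :: "complex^'d^'d \<Rightarrow> complex^'d \<Rightarrow> complex" where
  "qform A v = (\<Sum>i\<in>UNIV. \<Sum>j\<in>UNIV. cnj (v $ i) * A $ i $ j * v $ j)"

definition cdot :: "complex^'d \<Rightarrow> complex^'d \<Rightarrow> complex" where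
  "cdot v w = (\<Sum>i\<in>UNIV. cnj (v $ i) * w $ i)"

definition outer :: "complex^'d \<Rightarrow> complex^'d^'d" where
  "outer v = (\<chi> i j. v $ i * cnj (v $ j))"

definition hermitian :: "complex^'d^'d \<Rightarrow> bool" where
  "hermitian A \<longleftrightarrow> (\<forall>i j. A $ i $ j = cnj (A $ j $ i))"

lemma psd_qform: "psd A \<longleftrightarrow> (\<forall>v. qform A v \<in> \<real> \<and> 0 \<le> Re (qform A v))"
  by (simp add: psd_def qform_def matrix_vector_mult_def sum_distrib_left mult.assoc)

lemma sum_two_points:
  assumes "i \<noteq> j" "\<And>k. k \<noteq> i \<Longrightarrow> k \<noteq> j \<Longrightarrow> f k = 0"
  shows "(\<Sum>k\<in>UNIV. f (k::'d::finite)) = f i + (f j :: 'a::comm_monoid_add)"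
proof -
  have "(\<Sum>k\<in>UNIV. f k) = (\<Sum>k\<in>{i, j}. f k)"
    using assms(2) by (intro sum.mono_neutral_right) auto
  then show ?thesis
    using assms(1) by simp
qed

lemma qform_axis: "qform A (axis i a) = of_real ((cmod a)\<^sup>2) * A $ i $ i"
proof -
  have "qform A (axis i a) = (\<Sum>k\<in>UNIV. \<Sum>l\<in>UNIV. if k = i then (if l = i then cnj a * A $ i $ i * a else 0) else 0)"
    unfolding qform_def by (intro sum.cong) (auto simp: axis_def)
  also have "\<dots> = cnj a * A $ i $ i * a"
    by (simp add: sum.If_cases)
  finally show ?thesis
    by (simp add: complex_norm_square mult_ac del: of_real_power)
qed

lemma qform_two_axes:
  assumes "i \<noteq> j"
  shows "qform A (axis i a + axis j b) =
    of_real ((cmod a)\<^sup>2) * A $ i $ i + cnj a * A $ i $ j * b + cnj b * A $ j $ i * a + of_real ((cmod b)\<^sup>2) * A $ j $ j"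
proof -
  let ?v = "axis i a + axis j b"
  have v: "?v $ i = a" "?v $ j = b" "\<And>k. k \<noteq> i \<Longrightarrow> k \<noteq> j \<Longrightarrow> ?v $ k = 0"
    using assms by (auto simp: axis_def)
  have *: "(\<Sum>l\<in>UNIV. cnj (?v $ k) * A $ k $ l * ?v $ l) =
      cnj (?v $ k) * A $ k $ i * a + cnj (?v $ k) * A $ k $ j * b" for k
    by (subst sum_two_points[OF assms]) (simp_all add: v del: vector_add_component)
  show ?thesis
    unfolding qform_def *
    by (subst sum_two_points[OF assms]) (simp_all add: v complex_norm_square algebra_simps
        del: vector_add_component of_real_power)
qed

lemma psd_diag:
  assumes "psd A"
  shows "A $ i $ i \<in> \<real>" "0 \<le> Re (A $ i $ i)"
  using assms[unfolded psd_qform, rule_format, of "axis i 1"] by (simp_all add: qform_axis)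

text \<open>Polarisation: reality of the form on \<open>e_i + e_j\<close> fixes the imaginary part
  of \<open>A_ij + A_ji\<close>, and on \<open>e_i + i e_j\<close> the real part of
  \<open>A_ij - A_ji\<close>.\<close>

lemma psd_hermitian:
  assumes "psd A"
  shows "hermitian A"
  unfolding hermitian_def
proof (intro allI)
  fix i j
  show "A $ i $ j = cnj (A $ j $ i)"
  proof (cases "i = j")
    case True
    then show ?thesis
      using psd_diag(1)[OF assms, of i] by (simp add: Reals_cnj_iff)
  next
    case False
    have D: "Im (A $ i $ i) = 0" "Im (A $ j $ j) = 0"
      using psd_diag(1)[OF assms] by (simp_all add: complex_is_Real_iff)
    have "Im (qform A (axis i a + axis j b)) = 0" for a b
      using assms by (simp add: psd_qform complex_is_Real_iff)
    from this[of 1 1] this[of 1 \<i>] show ?thesis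
      unfolding qform_two_axes[OF False] using D by (simp add: complex_eq_iff)
  qed
qed

text \<open>Nonnegativity of a 2 x 2 principal minor, read off from the form on the plane spanned by
  two axes.\<close>

lemma psd_entry_bound:
  assumes "psd A"
  shows "(cmod (A $ i $ j))\<^sup>2 \<le> Re (A $ i $ i) * Re (A $ j $ j)"
proof (cases "i = j")
  case True
  have "Im (A $ j $ j) = 0"
    using psd_diag(1)[OF assms] by (simp add: complex_is_Real_iff)
  with True show ?thesis
    by (simp add: cmod_power2) (simp add: power2_eq_square)
next
  case False
  let ?a = "Re (A $ i $ i)" and ?b = "Re (A $ j $ j)" and ?c = "A $ i $ j"
  have ji: "A $ j $ i = cnj ?c"
    using psd_hermitian[OF assms] unfolding hermitian_def by blast
  have D: "Im (A $ i $ i) = 0" "Im (A $ j $ j) = 0"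
    using psd_diag(1)[OF assms] by (simp_all add: complex_is_Real_iff)
  have nn: "0 \<le> ?a" "0 \<le> ?b"
    using psd_diag(2)[OF assms] by auto
  \<comment> \<open>The coefficient \<open>- cnj ?c\<close> has its phase chosen so that the cross
    terms become real and the form is a real quadratic in \<open>t\<close>.\<close>
  have q: "0 \<le> t\<^sup>2 * ?a - 2 * t * (cmod ?c)\<^sup>2 + (cmod ?c)\<^sup>2 * ?b" for t :: real
  proof -
    have "0 \<le> Re (qform A (axis i (of_real t) + axis j (- cnj ?c)))"
      using assms by (simp add: psd_qform)
    also have "\<dots> = t\<^sup>2 * ?a - 2 * t * (cmod ?c)\<^sup>2 + (cmod ?c)\<^sup>2 * ?b"
      unfolding qform_two_axes[OF False] ji using D
      by (simp add: cmod_power2) (simp add: algebra_simps power2_eq_square)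
    finally show ?thesis .
  qed
  show ?thesis
  proof (cases "?a = 0")
    case True
    show ?thesis
    proof (cases "?c = 0")
      case False
      then have c: "(cmod ?c)\<^sup>2 > 0" by simp
      \<comment> \<open>With \<open>?a = 0\<close> the quadratic is affine in \<open>t\<close>, and
        \<open>t = ?b + 1\<close> makes it negative unless \<open>?c = 0\<close>.\<close>
      have "0 \<le> (cmod ?c)\<^sup>2 * (?b - 2 * (?b + 1))"
        using q[of "?b + 1"] True by (simp add: algebra_simps)
      then have "0 \<le> ?b - 2 * (?b + 1)"
        using c by (simp add: zero_le_mult_iff)
      then show ?thesis using nn by simp
    qed (use nn in simp)
  next
    case False
    then have a: "?a > 0" using nn by simp
    show ?thesis
    proof (cases "?c = 0")
      case False
      then have c: "(cmod ?c)\<^sup>2 > 0" by simp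
      \<comment> \<open>The quadratic at the vertex \<open>t = (cmod ?c)^2 / ?a\<close> of the
        parabola, multiplied by \<open>?a\<close>.\<close>
      have "0 \<le> ?a * (((cmod ?c)\<^sup>2 / ?a)\<^sup>2 * ?a - 2 * ((cmod ?c)\<^sup>2 / ?a) * (cmod ?c)\<^sup>2 + (cmod ?c)\<^sup>2 * ?b)"
        using q[of "(cmod ?c)\<^sup>2 / ?a"] a by (intro mult_nonneg_nonneg) auto
      also have "\<dots> = (cmod ?c)\<^sup>2 * (?a * ?b - (cmod ?c)\<^sup>2)"
        using a by (simp add: field_simps power2_eq_square)
      finally show ?thesis
        using c by (simp add: zero_le_mult_iff)
    qed (use nn in simp)
  qed
qed

section \<open>The real Hilbert-Schmidt inner product\<close>

lemma inner_matrix_eq: "A \<bullet> B = Re (\<Sum>i\<in>UNIV. \<Sum>j\<in>UNIV. A $ i $ j * cnj (B $ i $ j))"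
  for A B :: "complex^'d^'d"
  by (simp add: inner_vec_def inner_complex_def)

text \<open>Hermiticity absorbs the conjugate in the Euclidean inner product of complex matrices.
  Probabilities thus become real inner products, and Cauchy-Schwarz and orthogonal projection apply
  to them directly.\<close>

lemma Re_trace_mult:
  assumes "hermitian B"
  shows "Re (trace (A ** B)) = A \<bullet> B"
proof -
  have "trace (A ** B) = (\<Sum>i\<in>UNIV. \<Sum>j\<in>UNIV. A $ i $ j * cnj (B $ i $ j))"
  proof -
    have "cnj (B $ i $ j) = B $ j $ i" for i j
      using assms unfolding hermitian_def by metis
    then show ?thesis
      by (simp add: trace_def matrix_matrix_mult_def)
  qed
  then show ?thesis
    by (simp add: inner_matrix_eq)
qed

lemma inner_mat_1: "A \<bullet> mat 1 = Re (trace A)" for A :: "complex^'d^'d"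
proof -
  have "hermitian (mat 1 :: complex^'d^'d)"
    by (simp add: hermitian_def mat_def)
  from Re_trace_mult[OF this, of A] show ?thesis
    by simp
qed

text \<open>Summing the minors gives \<open>Tr A^2 \<le> (Tr A)^2\<close>. This bounds the index of
  coincidence, dominates operator-valued integrands by their traces, and forces a positive operator
  of trace 0 to vanish.\<close>

lemma psd_norm_le_trace:
  assumes "psd A"
  shows "norm A \<le> Re (trace A)"
proof -
  have tr: "Re (trace A) = (\<Sum>i\<in>UNIV. Re (A $ i $ i))"
    by (simp add: trace_def)
  have "(norm A)\<^sup>2 = (\<Sum>i\<in>UNIV. \<Sum>j\<in>UNIV. (cmod (A $ i $ j))\<^sup>2)"
    by (simp add: power2_norm_eq_inner inner_vec_def)
  also have "\<dots> \<le> (\<Sum>i\<in>UNIV. \<Sum>j\<in>UNIV. Re (A $ i $ i) * Re (A $ j $ j))"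
    by (intro sum_mono psd_entry_bound assms)
  also have "\<dots> = (Re (trace A))\<^sup>2"
    by (simp add: tr power2_eq_square sum_product)
  finally show ?thesis
    by (rule power2_le_imp_le) (simp add: tr sum_nonneg psd_diag(2)[OF assms])
qed

lemma psd_trace_nonneg: "psd A \<Longrightarrow> 0 \<le> Re (trace A)"
  using psd_norm_le_trace[of A] norm_ge_zero[of A] by linarith

lemma qform_outer: "qform (outer v) w = of_real ((cmod (cdot v w))\<^sup>2)"
proof -
  have "qform (outer v) w = (\<Sum>i\<in>UNIV. cnj (w $ i) * v $ i) * (\<Sum>j\<in>UNIV. cnj (v $ j) * w $ j)"
    by (simp add: qform_def outer_def sum_product mult_ac)
  also have "(\<Sum>i\<in>UNIV. cnj (w $ i) * v $ i) = cnj (cdot v w)"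
    by (simp add: cdot_def mult.commute)
  finally show ?thesis
    by (simp add: complex_norm_square cdot_def mult.commute del: of_real_power)
qed

lemma psd_outer: "psd (outer v)"
  by (simp add: psd_qform qform_outer)

lemma inner_outer_eq_qform: "outer v \<bullet> A = Re (qform A v)"
proof -
  have "Re (\<Sum>i\<in>UNIV. \<Sum>j\<in>UNIV. outer v $ i $ j * cnj (A $ i $ j)) = Re (cnj (qform A v))"
    by (simp add: qform_def outer_def mult_ac)
  then show ?thesis
    by (simp add: inner_matrix_eq)
qed

lemma inner_outer: "outer v \<bullet> outer w = (cmod (cdot v w))\<^sup>2"
  by (subst inner_commute) (simp add: inner_outer_eq_qform qform_outer)

lemma norm_vec_cmod: "(norm v)\<^sup>2 = (\<Sum>i\<in>UNIV. (cmod (v $ i))\<^sup>2)" for v :: "complex^'d"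
  by (simp add: power2_norm_eq_inner inner_vec_def)

lemma cdot_self: "cdot v v = of_real ((norm v)\<^sup>2)"
  by (simp add: norm_vec_cmod cdot_def complex_norm_square mult.commute del: of_real_power)

lemma trace_outer: "trace (outer v) = of_real ((norm v)\<^sup>2)"
  by (simp add: norm_vec_cmod trace_def outer_def complex_norm_square del: of_real_power)

text \<open>All rows are multiples of one vector, so \<open>X_ij X_kk = X_ik X_kj\<close>. The
  column through a nonzero diagonal entry, divided by the square root of that entry, is therefore
  the required vector; the positive trace supplies such an entry.\<close>

lemma psd_rank_one_eq_outer:
  assumes "psd X" "rank X = 1" "trace X = of_real l" "l > 0"
  obtains v where "X = outer v" "(norm v)\<^sup>2 = l"
proof -
  have "vec.dim (rows X) = 1"
    using assms(2) by (simp add: row_rank_def_gen)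
  then obtain B where B: "B \<subseteq> rows X" "rows X \<subseteq> vec.span B" "card B = 1"
    using vec.basis_exists[of "rows X"] by metis
  then obtain b where "B = {b}"
    by (meson card_1_singletonE)
  then have "\<exists>k. row i X = k *s b" for i
    using B(2) by (auto simp: rows_def vec.span_singleton)
  then obtain u where u: "row i X = u i *s b" for i
    by metis
  have X: "X $ i $ j = u i * b $ j" for i j
    using u[of i] by (simp add: row_def vec_eq_iff)
  have "\<exists>k. X $ k $ k \<noteq> 0"
  proof (rule ccontr)
    assume "\<nexists>k. X $ k $ k \<noteq> 0"
    then have "trace X = 0"
      by (simp add: trace_def)
    then show False
      using assms(3,4) by simp
  qed
  then obtain k where k: "X $ k $ k \<noteq> 0"
    by blast
  define t where "t = Re (X $ k $ k)"
  have t: "X $ k $ k = of_real t" "t > 0"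
    using k psd_diag[OF assms(1), of k] by (auto simp: t_def complex_eq_iff complex_is_Real_iff)
  define v where "v = (\<chi> i. X $ i $ k / of_real (sqrt t))"
  have "X $ i $ j = v $ i * cnj (v $ j)" for i j
  proof -
    have "X $ i $ j * of_real t = X $ i $ k * X $ k $ j"
      unfolding t(1)[symmetric] by (simp add: X)
    also have "X $ k $ j = cnj (X $ j $ k)"
      using psd_hermitian[OF assms(1)] unfolding hermitian_def by blast
    finally have "X $ i $ j = X $ i $ k * cnj (X $ j $ k) / of_real t"
      using t(2) by (simp add: field_simps)
    also have "\<dots> = v $ i * cnj (v $ j)"
      using t(2) by (simp add: v_def flip: of_real_mult)
    finally show ?thesis .
  qed
  then have *: "X = outer v"
    by (simp add: outer_def vec_eq_iff)
  moreover have "(norm v)\<^sup>2 = l"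
    using assms(3) unfolding * trace_outer of_real_eq_iff .
  ultimately show ?thesis
    using that by blast
qed

text \<open>Polarisation again, after homogeneity has reduced all vectors to unit vectors, the only
  ones for which the law of the Gaussian projection will be known.\<close>

lemma hermitian_eqI_qform:
  assumes "hermitian A" "hermitian B" "\<And>v. norm v = 1 \<Longrightarrow> Re (qform A v) = Re (qform B v)"
  shows "A = B"
proof -
  have q: "Re (qform A v) = Re (qform B v)" for v
  proof (cases "v = 0")
    case False
    define w where "w = (1 / norm v) *\<^sub>R v"
    have w: "norm w = 1" "v = norm v *\<^sub>R w"
      using False by (auto simp: w_def)
    have "qform C (norm v *\<^sub>R w) = (norm v)\<^sup>2 *\<^sub>R qform C w" for C
      by (simp add: qform_def scaleR_sum_right power2_eq_square)
    then have "Re (qform C v) = (norm v)\<^sup>2 * Re (qform C w)" for C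
      using w(2) by (metis scaleR_complex.simps(1))
    then show ?thesis
      using assms(3)[OF w(1)] by simp
  qed (simp add: qform_def)
  have "A $ i $ j = B $ i $ j" for i j
  proof -
    have im: "Im (A $ k $ k) = 0" "Im (B $ k $ k) = 0" for k
      using assms(1,2)[unfolded hermitian_def, rule_format, of k k] by (auto simp: complex_eq_iff)
    have d: "A $ k $ k = B $ k $ k" for k
      using q[of "axis k 1"] im[of k] by (simp add: qform_axis complex_eq_iff)
    have o: "A $ j $ i = cnj (A $ i $ j)" "B $ j $ i = cnj (B $ i $ j)"
      using assms(1,2) unfolding hermitian_def by blast+
    show ?thesis
    proof (cases "i = j")
      case False
      show ?thesis
        using q[of "axis i 1 + axis j 1"] q[of "axis i 1 + axis j \<i>"] d[of i] d[of j]
        unfolding qform_two_axes[OF False] o by (simp add: complex_eq_iff)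
    qed (use d in simp)
  qed
  then show ?thesis
    by (simp add: vec_eq_iff)
qed

section \<open>Positivity under sums and integrals\<close>

lemma hermitianD: "hermitian A \<Longrightarrow> cnj (A $ i $ j) = A $ j $ i"
  unfolding hermitian_def by metis

lemma cnj_qform: "hermitian A \<Longrightarrow> cnj (qform A v) = qform A v"
proof -
  assume A: "hermitian A"
  have "cnj (qform A v) = (\<Sum>i\<in>UNIV. \<Sum>j\<in>UNIV. cnj (v $ j) * A $ j $ i * v $ i)"
    by (simp add: qform_def hermitianD[OF A] mult_ac)
  also have "\<dots> = qform A v"
    unfolding qform_def by (rule sum.swap)
  finally show ?thesis .
qed

text \<open>Real-linear conditions on \<open>A\<close> replace the statement about a complex
  quadratic form, and such conditions pass through sums and Bochner integrals.\<close>

lemma psd_iff: "psd A \<longleftrightarrow> hermitian A \<and> (\<forall>v. 0 \<le> outer v \<bullet> A)"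
proof
  assume A: "psd A"
  then show "hermitian A \<and> (\<forall>v. 0 \<le> outer v \<bullet> A)"
    using psd_hermitian[OF A] by (simp add: psd_qform inner_outer_eq_qform)
next
  assume A: "hermitian A \<and> (\<forall>v. 0 \<le> outer v \<bullet> A)"
  then have "qform A v \<in> \<real>" for v
    unfolding Reals_cnj_iff using cnj_qform by blast
  moreover have "0 \<le> Re (qform A v)" for v
    using A by (simp add: inner_outer_eq_qform)
  ultimately show "psd A"
    by (simp add: psd_qform)
qed

lemma psd_scaleR:
  assumes "0 \<le> c" "psd A"
  shows "psd (c *\<^sub>R A)"
proof -
  have "hermitian (c *\<^sub>R A)"
    unfolding hermitian_def using hermitianD[OF psd_hermitian[OF assms(2)]] by simp
  then show ?thesis
    using assms by (simp add: psd_iff)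
qed

lemma psd_sum:
  assumes "\<And>i. i \<in> I \<Longrightarrow> psd (T i)"
  shows "psd (\<Sum>i\<in>I. T i)"
proof -
  have "hermitian (T i)" if "i \<in> I" for i
    using assms[OF that] psd_hermitian by blast
  then have "hermitian (\<Sum>i\<in>I. T i)"
    unfolding hermitian_def[of "sum _ _"] by (simp add: hermitianD)
  moreover have "0 \<le> outer v \<bullet> (\<Sum>i\<in>I. T i)" for v
    unfolding inner_sum_right using assms by (intro sum_nonneg) (simp add: psd_iff)
  ultimately show ?thesis
    by (simp add: psd_iff)
qed

lemma hermitian_integral:
  fixes f :: "'a \<Rightarrow> complex^'d^'d"
  assumes int: "integrable M f" and h: "\<And>z. z \<in> space M \<Longrightarrow> hermitian (f z)"
  shows "hermitian (integral\<^sup>L M f)"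
  unfolding hermitian_def
proof (intro allI)
  fix i j
  have bl: "bounded_linear (\<lambda>A :: complex^'d^'d. A $ i $ j)" for i j
    by (intro bounded_linear_compose[OF bounded_linear_vec_nth bounded_linear_vec_nth])
  have entry: "integral\<^sup>L M f $ i $ j = (\<integral>z. f z $ i $ j \<partial>M)" for i j
    using integral_bounded_linear[OF bl int] by simp
  have "integral\<^sup>L M f $ i $ j = (\<integral>z. cnj (f z $ j $ i) \<partial>M)"
    unfolding entry using hermitianD[OF h] by (intro Bochner_Integration.integral_cong) simp_all
  also have "\<dots> = cnj (integral\<^sup>L M f $ j $ i)"
    unfolding entry
    by (rule integral_bounded_linear[OF bounded_linear_cnj integrable_bounded_linear[OF bl int]])
  finally show "integral\<^sup>L M f $ i $ j = cnj (integral\<^sup>L M f $ j $ i)" .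
qed

lemma psd_integral:
  fixes f :: "'a \<Rightarrow> complex^'d^'d"
  assumes int: "integrable M f" and h: "\<And>z. z \<in> space M \<Longrightarrow> psd (f z)"
  shows "psd (integral\<^sup>L M f)"
proof -
  have "0 \<le> outer v \<bullet> integral\<^sup>L M f" for v
  proof -
    have "outer v \<bullet> integral\<^sup>L M f = (\<integral>z. outer v \<bullet> f z \<partial>M)"
      using int by simp
    also have "\<dots> \<ge> 0"
      using h by (intro integral_nonneg_AE AE_I2) (simp add: psd_iff)
    finally show ?thesis .
  qed
  moreover have "hermitian (integral\<^sup>L M f)"
    using int h psd_hermitian by (intro hermitian_integral) auto
  ultimately show ?thesis
    by (simp add: psd_iff)
qed

section \<open>Symmetric informationally complete sets\<close>

text \<open>The Gram data alone determine the squared norm of the difference of the two sides, and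
  it comes out as 0.\<close>

lemma sic_gram_sum:
  fixes X :: "'i \<Rightarrow> 'v::real_inner" and e :: 'v
  assumes "finite A" "card A = d\<^sup>2" "e \<bullet> e = real d"
    and "\<And>x. x \<in> A \<Longrightarrow> X x \<bullet> e = l"
    and "\<And>x y. x \<in> A \<Longrightarrow> y \<in> A \<Longrightarrow> X x \<bullet> X y = (if x = y then l\<^sup>2 else l\<^sup>2 / (real d + 1))"
  shows "(\<Sum>x\<in>A. X x) = (real d * l) *\<^sub>R e"
proof -
  let ?S = "\<Sum>x\<in>A. X x" and ?d = "real d"
  have Se: "?S \<bullet> e = ?d\<^sup>2 * l"
    using assms(2,4) by (simp add: inner_sum_left)
  have "?S \<bullet> X y = ?d * l\<^sup>2" if y: "y \<in> A" for y
  proof -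
    have "?S \<bullet> X y = (\<Sum>x\<in>A. l\<^sup>2 / (?d + 1) + (if x = y then l\<^sup>2 - l\<^sup>2 / (?d + 1) else 0))"
      unfolding inner_sum_left using y assms(5) by (intro sum.cong) auto
    also have "\<dots> = ?d\<^sup>2 * (l\<^sup>2 / (?d + 1)) + (l\<^sup>2 - l\<^sup>2 / (?d + 1))"
      using y assms(1,2) by (simp add: sum.distrib)
    also have "\<dots> = ?d * l\<^sup>2"
    proof -
      have "?d + 1 \<noteq> 0"
        by linarith
      then show ?thesis
        by (simp add: divide_simps) (simp add: power2_eq_square algebra_simps)
    qed
    finally show ?thesis .
  qed
  then have SS: "?S \<bullet> ?S = ?d\<^sup>2 * (?d * l\<^sup>2)"
    using assms(2) by (simp add: inner_sum_right)
  have "(?S - (?d * l) *\<^sub>R e) \<bullet> (?S - (?d * l) *\<^sub>R e) =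
      ?S \<bullet> ?S - 2 * (?d * l) * (?S \<bullet> e) + (?d * l)\<^sup>2 * (e \<bullet> e)"
    by (simp add: inner_diff_left inner_diff_right inner_commute power2_eq_square algebra_simps)
  also have "\<dots> = 0"
    unfolding SS Se assms(3) by (simp add: power2_eq_square algebra_simps)
  finally show ?thesis by simp
qed

text \<open>
  Bessel's inequality: the numbers \<open>b x\<close> below are the coefficients of the orthogonal projection of
  \<open>s\<close> onto the span of the \<open>X x\<close>.
\<close>

lemma sic_gram_bessel:
  fixes X :: "'i \<Rightarrow> 'v::real_inner" and e s :: 'v
  assumes "finite A" "card A = d\<^sup>2" "e \<bullet> e = real d" "d > 0" "l > 0"
    and "\<And>x. x \<in> A \<Longrightarrow> X x \<bullet> e = l"
    and G: "\<And>x y. x \<in> A \<Longrightarrow> y \<in> A \<Longrightarrow> X x \<bullet> X y = (if x = y then l\<^sup>2 else l\<^sup>2 / (real d + 1))"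
  shows "(\<Sum>x\<in>A. (X x \<bullet> s)\<^sup>2) \<le> l\<^sup>2 * real d / (real d + 1) * (s \<bullet> s + (s \<bullet> e)\<^sup>2)"
proof -
  let ?d = "real d" and ?a = "\<lambda>x. X x \<bullet> s" and ?t = "s \<bullet> e"
  \<comment> \<open>The Gram matrix is \<open>l^2 / (d + 1)\<close> times \<open>d\<close> times the
    identity plus the all-ones matrix. If it maps \<open>b\<close> to the vector of the
    \<open>X x \<bullet> s\<close>, then the \<open>b x\<close> sum to \<open>t / l\<close>, where
    \<open>t = s \<bullet> e\<close>, and solving for \<open>b x\<close> gives this formula.\<close>
  define b where "b x = ((?d + 1) / l\<^sup>2 * ?a x - ?t / l) / ?d" for x
  have S: "(\<Sum>x\<in>A. X x) = (?d * l) *\<^sub>R e"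
    by (rule sic_gram_sum) (use assms in auto)
  have sa: "(\<Sum>x\<in>A. ?a x) = ?d * l * ?t"
    by (simp add: S inner_commute[of e] flip: inner_sum_left)
  have sb: "(\<Sum>x\<in>A. b x) = ?t / l"
  proof -
    have "(\<Sum>x\<in>A. b x) = ((?d + 1) / l\<^sup>2 * (\<Sum>x\<in>A. ?a x) - ?d\<^sup>2 * (?t / l)) / ?d"
      using assms(2) by (simp add: b_def sum_subtractf flip: sum_divide_distrib sum_distrib_left)
    also have "\<dots> = ?t / l"
      unfolding sa using assms(4,5) by (simp add: field_simps power2_eq_square)
    finally show ?thesis .
  qed
  have Xy: "(\<Sum>x\<in>A. b x *\<^sub>R X x) \<bullet> X y = ?a y" if y: "y \<in> A" for y
  proof -
    have "(\<Sum>x\<in>A. b x *\<^sub>R X x) \<bullet> X y =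
        (\<Sum>x\<in>A. l\<^sup>2 / (?d + 1) * b x + (if x = y then (l\<^sup>2 - l\<^sup>2 / (?d + 1)) * b y else 0))"
      unfolding inner_sum_left using y G by (intro sum.cong) (auto simp: algebra_simps)
    also have "\<dots> = l\<^sup>2 / (?d + 1) * (?t / l) + (l\<^sup>2 - l\<^sup>2 / (?d + 1)) * b y"
      using y assms(1) by (simp add: sum.distrib flip: sb sum_divide_distrib sum_distrib_left)
    also have "l\<^sup>2 - l\<^sup>2 / (?d + 1) = l\<^sup>2 / (?d + 1) * ?d"
      by (simp add: field_simps)
    also have "l\<^sup>2 / (?d + 1) * ?d * b y = l\<^sup>2 / (?d + 1) * ((?d + 1) / l\<^sup>2 * ?a y - ?t / l)"
      using assms(4) by (simp add: b_def)
    also have "l\<^sup>2 / (?d + 1) * (?t / l) + \<dots> = ?a y"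
      using assms(5) by (simp add: right_diff_distrib)
    finally show ?thesis .
  qed
  let ?w = "\<Sum>x\<in>A. b x *\<^sub>R X x"
  have ws: "?w \<bullet> s = (\<Sum>x\<in>A. b x * ?a x)"
    by (simp add: inner_sum_left)
  have ww: "?w \<bullet> ?w = (\<Sum>x\<in>A. b x * ?a x)"
    using Xy by (subst inner_sum_right) simp
  \<comment> \<open>The squared distance of \<open>s\<close> from its projection; the equations for
    \<open>?w\<close> reduce it to one sum.\<close>
  have "0 \<le> (s - ?w) \<bullet> (s - ?w)"
    by simp
  also have "\<dots> = s \<bullet> s - (\<Sum>x\<in>A. b x * ?a x)"
    using ws ww by (simp add: inner_diff_left inner_diff_right inner_commute)
  also have "(\<Sum>x\<in>A. b x * ?a x) = ((?d + 1) / l\<^sup>2 * (\<Sum>x\<in>A. (?a x)\<^sup>2) - ?t / l * (\<Sum>x\<in>A. ?a x)) / ?d"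
    by (simp add: b_def sum_distrib_left sum_divide_distrib sum_subtractf power2_eq_square
        left_diff_distrib diff_divide_distrib mult.assoc)
  also have "\<dots> = (?d + 1) / (?d * l\<^sup>2) * (\<Sum>x\<in>A. (?a x)\<^sup>2) - ?t\<^sup>2"
    unfolding sa using assms(4,5) by (simp add: field_simps power2_eq_square)
  finally have "(?d + 1) / (?d * l\<^sup>2) * (\<Sum>x\<in>A. (?a x)\<^sup>2) \<le> s \<bullet> s + ?t\<^sup>2"
    by simp
  then show ?thesis
    using assms(4,5) by (simp add: field_simps)
qed

section \<open>Frame identities for SIC operators\<close>

lemma finite_sic_index: "finite (sic_index n)"
  and card_sic_index: "card (sic_index n) = n\<^sup>2"
  by (auto simp: sic_index_def card_image)

text \<open>The free scale \<open>l\<close> covers the ensemble, \<open>l = 1 / d^2\<close>, and the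
  POVM, \<open>l = 1 / d\<close>.\<close>

locale sic =
  fixes l :: real and X :: "real \<Rightarrow> complex^'d^'d"
  assumes pos: "l > 0" and set: "is_sic_set l X"
begin

lemma psd: "x \<in> sic_index CARD('d) \<Longrightarrow> psd (X x)"
  using set by (simp add: is_sic_set_def)

lemma trace: "x \<in> sic_index CARD('d) \<Longrightarrow> trace (X x) = of_real l"
  using set by (simp add: is_sic_set_def)

lemma ex_outer: "x \<in> sic_index CARD('d) \<Longrightarrow> \<exists>v. X x = outer v \<and> (norm v)\<^sup>2 = l"
  using set pos psd_rank_one_eq_outer[of "X x" l] unfolding is_sic_set_def by metis

definition ket :: "real \<Rightarrow> complex^'d" where
  "ket x = (SOME v. X x = outer v \<and> (norm v)\<^sup>2 = l)"

lemma ket: "x \<in> sic_index CARD('d) \<Longrightarrow> X x = outer (ket x)" "x \<in> sic_index CARD('d) \<Longrightarrow> (norm (ket x))\<^sup>2 = l"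
  using someI_ex[OF ex_outer] unfolding ket_def by auto

lemma inner_psd_nonneg: "x \<in> sic_index CARD('d) \<Longrightarrow> psd A \<Longrightarrow> 0 \<le> X x \<bullet> A"
  by (simp add: ket(1) inner_outer_eq_qform psd_qform)

lemma inner_one: "x \<in> sic_index CARD('d) \<Longrightarrow> X x \<bullet> mat 1 = l"
  by (simp add: inner_mat_1 trace)

text \<open>The diagonal comes from rank one, where \<open>Tr X^2 = (Tr X)^2\<close>; the rest is
  the defining overlap.\<close>

lemma gram:
  assumes "x \<in> sic_index CARD('d)" "y \<in> sic_index CARD('d)"
  shows "X x \<bullet> X y = (if x = y then l\<^sup>2 else l\<^sup>2 / (real CARD('d) + 1))"
proof (cases "x = y")
  case True
  then show ?thesis
    using assms by (simp add: ket inner_outer cdot_self)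
next
  case False
  then have "trace (X x ** X y) = of_real (l\<^sup>2 / (real CARD('d) + 1))"
    using assms set by (simp add: is_sic_set_def)
  then have "X x \<bullet> X y = Re (of_real (l\<^sup>2 / (real CARD('d) + 1)))"
    by (simp only: Re_trace_mult[OF psd_hermitian[OF psd[OF assms(2)]], symmetric])
  with False show ?thesis
    by simp
qed

lemma mat_1_inner_self: "(mat 1 :: complex^'d^'d) \<bullet> mat 1 = real CARD('d)"
  by (simp add: inner_mat_1 trace_I)

lemma sum_eq: "(\<Sum>x\<in>sic_index CARD('d). X x) = (real CARD('d) * l) *\<^sub>R mat 1"
  by (rule sic_gram_sum[OF finite_sic_index card_sic_index mat_1_inner_self inner_one gram])

lemma sum_inner: "(\<Sum>x\<in>sic_index CARD('d). X x \<bullet> A) = real CARD('d) * l * Re (trace A)"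
  by (simp add: sum_eq inner_commute[of "mat 1"] inner_mat_1 flip: inner_sum_left)

text \<open>Bessel's inequality contributes \<open>A \<bullet> A\<close> and
  \<open>(Tr A)^2\<close>; bounding the first by the second produces the factor 2. Dividing by
  \<open>(d l Tr A)^2\<close> turns the bound into \<open>2 / (d (d + 1))\<close> for a probability
  vector.\<close>

lemma coincidence:
  assumes "psd A"
  shows "(\<Sum>x\<in>sic_index CARD('d). (X x \<bullet> A)\<^sup>2) \<le> 2 * l\<^sup>2 * real CARD('d) / (real CARD('d) + 1) * (Re (trace A))\<^sup>2"
proof -
  have "A \<bullet> A \<le> (Re (trace A))\<^sup>2"
    using psd_norm_le_trace[OF assms] norm_ge_zero[of A] power_mono[of "norm A" "Re (trace A)" 2]
    by (simp add: power2_norm_eq_inner)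
  then have "l\<^sup>2 * real CARD('d) / (real CARD('d) + 1) * (A \<bullet> A + (Re (trace A))\<^sup>2) \<le>
      l\<^sup>2 * real CARD('d) / (real CARD('d) + 1) * (2 * (Re (trace A))\<^sup>2)"
    by (intro mult_left_mono) auto
  then show ?thesis
    using sic_gram_bessel[OF finite_sic_index card_sic_index mat_1_inner_self _ pos inner_one gram, of A]
    by (simp add: inner_mat_1)
qed

end

section \<open>Upper bounds\<close>

text \<open>
  Writing \<open>p / (q r) = c \<cdot> (p N / (c r)) \<cdot> (1 / (N q))\<close> with \<open>N = card A\<close>, the inequality \<open>ln t \<le> t - 1\<close> for
  the last two factors bounds the integrand by terms that integrate to at most \<open>ln c\<close> in total.
\<close>

lemma sum_integral_log_ratio_le:
  fixes p :: "'a \<Rightarrow> 'b \<Rightarrow> real"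
  assumes "finite A" "A \<noteq> {}" "c > 0"
    and int: "\<And>x. x \<in> A \<Longrightarrow> integrable M (p x)"
    and nn: "\<And>x y. x \<in> A \<Longrightarrow> y \<in> space M \<Longrightarrow> 0 \<le> p x y"
    and r: "\<And>y. y \<in> space M \<Longrightarrow> r y = (\<Sum>x\<in>A. p x y)"
    and r1: "(\<integral>y. r y \<partial>M) = 1"
    and coinc: "\<And>y. y \<in> space M \<Longrightarrow> (\<Sum>x\<in>A. (p x y)\<^sup>2) \<le> c / real (card A) * (r y)\<^sup>2"
    and q: "\<And>x. x \<in> A \<Longrightarrow> q x = (\<integral>y. p x y \<partial>M)"
    and F: "\<And>x. x \<in> A \<Longrightarrow> integrable M (\<lambda>y. p x y * log 2 (p x y / (q x * r y)))"
  shows "(\<Sum>x\<in>A. \<integral>y. p x y * log 2 (p x y / (q x * r y)) \<partial>M) \<le> log 2 c"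
proof -
  define N where "N = real (card A)"
  have N: "N > 0"
    using assms(1,2) by (simp add: N_def card_gt_0_iff)
  have rint: "integrable M r"
    using int r by (subst Bochner_Integration.integrable_cong[OF refl r]) auto
  have rm[measurable]: "r \<in> borel_measurable M"
    using rint by auto
  have pm[measurable]: "x \<in> A \<Longrightarrow> p x \<in> borel_measurable M" for x
    using int by auto
  have ple: "p x y \<le> r y" if "x \<in> A" "y \<in> space M" for x y
    unfolding r[OF that(2)] using that nn assms(1) by (intro member_le_sum) auto
  have rnn: "0 \<le> r y" if "y \<in> space M" for y
    using that nn by (simp add: r sum_nonneg)
  \<comment> \<open>Where \<open>r y = 0\<close>, all \<open>p x y\<close> vanish too and the
    quotient has the default value 0.\<close>
  have sq: "0 \<le> (p x y)\<^sup>2 / r y" "(p x y)\<^sup>2 / r y \<le> p x y" if "x \<in> A" "y \<in> space M" for x y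
    using ple[OF that] nn[OF that] rnn[OF that(2)]
    by (auto simp: power2_eq_square divide_le_eq intro: mult_left_mono)
  have sqint: "integrable M (\<lambda>y. (p x y)\<^sup>2 / r y)" if x: "x \<in> A" for x
  proof (rule Bochner_Integration.integrable_bound[OF int[OF x]])
    have "norm ((p x y)\<^sup>2 / r y) \<le> norm (p x y)" if y: "y \<in> space M" for y
      using sq[OF x y] by (simp del: abs_divide)
    then show "AE y in M. norm ((p x y)\<^sup>2 / r y) \<le> norm (p x y)"
      by (rule AE_I2)
  qed (use x in measurable)
  define h where "h x y = (p x y)\<^sup>2 / r y" for x y
  define S where "S x = (\<integral>y. h x y \<partial>M)" for x
  have hint: "integrable M (h x)" if "x \<in> A" for x
    using sqint[OF that] by (simp add: h_def[abs_def])
  have Snn: "S x \<ge> 0" if "x \<in> A" for x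
    unfolding S_def h_def using sq(1)[OF that] by (intro integral_nonneg_AE) auto
  have qnn: "q x \<ge> 0" if "x \<in> A" for x
    unfolding q[OF that] using nn[OF that] by (intro integral_nonneg_AE) auto
  have bound: "(\<integral>y. p x y * log 2 (p x y / (q x * r y)) \<partial>M) \<le>
      (q x * ln c + (N / c * S x - q x) + (1 / N - q x)) / ln 2" if x: "x \<in> A" for x
  proof (cases "q x = 0")
    \<comment> \<open>The tangent inequality divides by \<open>q x\<close>. If
      \<open>q x = 0\<close>, the integral is 0 and it suffices that the right-hand side is
      nonnegative.\<close>
    case True
    have "AE y in M. p x y = 0"
      using True nn[OF x] int[OF x]
      by (subst integral_nonneg_eq_0_iff_AE[symmetric]) (auto simp: q[OF x])
    then have "(\<integral>y. p x y * log 2 (p x y / (q x * r y)) \<partial>M) = 0"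
      by (intro integral_eq_zero_AE) auto
    then show ?thesis
      using N Snn[OF x] assms(3) by (simp only: True) simp
  next
    case False
    then have qpos: "q x > 0"
      using qnn[OF x] by simp
    have pw: "p x y * log 2 (p x y / (q x * r y)) \<le>
        (p x y * ln c + (N / c * h x y - p x y) + (p x y / (N * q x) - p x y)) / ln 2"
      if y: "y \<in> space M" for y
    proof (cases "p x y = 0")
      case False
      then have pp: "p x y > 0" "r y > 0"
        using nn[OF x y] ple[OF x y] by auto
      have "ln (p x y / (q x * r y)) = ln c + ln (p x y * N / (c * r y)) + ln (1 / (N * q x))"
        using pp qpos N assms(3) by (simp add: ln_div ln_mult)
      also have "\<dots> \<le> ln c + (p x y * N / (c * r y) - 1) + (1 / (N * q x) - 1)"
        using pp qpos N assms(3) by (intro add_mono order_refl ln_le_minus_one) auto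
      finally have "p x y * ln (p x y / (q x * r y)) \<le>
          p x y * (ln c + (p x y * N / (c * r y) - 1) + (1 / (N * q x) - 1))"
        using pp by (intro mult_left_mono) auto
      also have "\<dots> = p x y * ln c + (N / c * h x y - p x y) + (p x y / (N * q x) - p x y)"
        by (simp add: h_def algebra_simps power2_eq_square)
      finally show ?thesis
        by (simp add: log_def divide_right_mono)
    qed (simp add: h_def)
    have "(\<integral>y. p x y * log 2 (p x y / (q x * r y)) \<partial>M) \<le>
      (\<integral>y. (p x y * ln c + (N / c * h x y - p x y) + (p x y / (N * q x) - p x y)) / ln 2 \<partial>M)"
      using int[OF x] hint[OF x] F[OF x] by (intro integral_mono pw) auto
    also have "\<dots> = (q x * ln c + (N / c * S x - q x) + (q x / (N * q x) - q x)) / ln 2"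
      using int[OF x] hint[OF x] by (simp add: q[OF x] S_def)
    finally show ?thesis
      using qpos by simp
  qed
  have sumq: "(\<Sum>x\<in>A. q x) = 1"
  proof -
    have "(\<Sum>x\<in>A. q x) = (\<integral>y. (\<Sum>x\<in>A. p x y) \<partial>M)"
      using int q by (simp add: Bochner_Integration.integral_sum)
    also have "\<dots> = (\<integral>y. r y \<partial>M)"
      using r by (intro Bochner_Integration.integral_cong) auto
    finally show ?thesis
      using r1 by simp
  qed
  have "(\<Sum>x\<in>A. S x) = (\<integral>y. (\<Sum>x\<in>A. (p x y)\<^sup>2 / r y) \<partial>M)"
    unfolding S_def h_def using sqint by (simp add: Bochner_Integration.integral_sum)
  also have "\<dots> \<le> (\<integral>y. c / N * r y \<partial>M)"
  proof (rule integral_mono)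
    fix y assume y: "y \<in> space M"
    have "(\<Sum>x\<in>A. (p x y)\<^sup>2 / r y) \<le> c / N * (r y)\<^sup>2 / r y"
      unfolding sum_divide_distrib[symmetric] N_def using coinc[OF y] rnn[OF y] by (rule divide_right_mono)
    also have "\<dots> = c / N * r y"
      by (simp add: power2_eq_square)
    finally show "(\<Sum>x\<in>A. (p x y)\<^sup>2 / r y) \<le> c / N * r y" .
  qed (use sqint rint in auto)
  also have "\<dots> = c / N"
    using r1 by simp
  finally have sumS: "(\<Sum>x\<in>A. S x) \<le> c / N" .
  have "(\<Sum>x\<in>A. \<integral>y. p x y * log 2 (p x y / (q x * r y)) \<partial>M) \<le>
      (\<Sum>x\<in>A. (q x * ln c + (N / c * S x - q x) + (1 / N - q x)) / ln 2)"
    by (intro sum_mono bound)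
  \<comment> \<open>Over all of \<open>A\<close> the terms \<open>1 / N - q x\<close> cancel, and
    the terms \<open>N / c * S x - q x\<close> add up to at most 0, because the \<open>S x\<close>
    sum to at most \<open>c / N\<close>.\<close>
  also have "\<dots> = (ln c + N / c * (\<Sum>x\<in>A. S x) - 1) / ln 2"
    using N by (simp add: sum.distrib sum_subtractf sumq N_def
        flip: sum_divide_distrib sum_distrib_left sum_distrib_right)
  also have "\<dots> \<le> (ln c + N / c * (c / N) - 1) / ln 2"
    using sumS N assms(3) by (intro divide_right_mono diff_right_mono add_left_mono mult_left_mono) auto
  also have "\<dots> = log 2 c"
    using N assms(3) by (simp add: log_def)
  finally show ?thesis .
qed

text \<open>Fubini yields integrable sections for almost every \<open>x\<close>, and almost
  everywhere for a counting measure means everywhere.\<close>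

lemma integral_count_space_pair_finite:
  fixes f :: "'a \<Rightarrow> 'b \<Rightarrow> real"
  assumes "finite A" "sigma_finite_measure M" "integrable (count_space A \<Otimes>\<^sub>M M) (\<lambda>(x, y). f x y)"
  shows "\<And>x. x \<in> A \<Longrightarrow> integrable M (f x)"
    and "(\<integral>(x, y). f x y \<partial>(count_space A \<Otimes>\<^sub>M M)) = (\<Sum>x\<in>A. \<integral>y. f x y \<partial>M)"
proof -
  interpret A: sigma_finite_measure "count_space A"
    using assms(1) by (rule sigma_finite_measure_count_space_finite)
  interpret M: sigma_finite_measure M by fact
  interpret pair_sigma_finite "count_space A" M ..
  show "integrable M (f x)" if "x \<in> A" for x
    using AE_integrable_fst'[OF assms(3)] that by (simp add: AE_count_space)
  show "(\<integral>(x, y). f x y \<partial>(count_space A \<Otimes>\<^sub>M M)) = (\<Sum>x\<in>A. \<integral>y. f x y \<partial>M)"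
    using integral_fst'[OF assms(3)] assms(1) by (simp add: lebesgue_integral_count_space_finite)
qed

lemma integral_pair_count_space_finite:
  fixes f :: "'b \<Rightarrow> 'a \<Rightarrow> real"
  assumes "finite A" "sigma_finite_measure M" "integrable (M \<Otimes>\<^sub>M count_space A) (\<lambda>(y, x). f y x)"
  shows "\<And>x. x \<in> A \<Longrightarrow> integrable M (\<lambda>y. f y x)"
    and "(\<integral>(y, x). f y x \<partial>(M \<Otimes>\<^sub>M count_space A)) = (\<Sum>x\<in>A. \<integral>y. f y x \<partial>M)"
proof -
  interpret A: sigma_finite_measure "count_space A"
    using assms(1) by (rule sigma_finite_measure_count_space_finite)
  interpret M: sigma_finite_measure M by fact
  interpret pair_sigma_finite M "count_space A" ..
  show "integrable M (\<lambda>y. f y x)" if "x \<in> A" for x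
    using AE_integrable_snd[OF assms(3)] that by (simp add: AE_count_space)
  show "(\<integral>(y, x). f y x \<partial>(M \<Otimes>\<^sub>M count_space A)) = (\<Sum>x\<in>A. \<integral>y. f y x \<partial>M)"
    using integral_snd[OF assms(3)] assms(1) by (simp add: lebesgue_integral_count_space_finite)
qed

text \<open>\<open>lebesgue\<close> is the completion of \<open>lborel\<close>, and a covering by
  sets of finite measure survives completion.\<close>

lemma sigma_finite_completion:
  assumes "sigma_finite_measure M"
  shows "sigma_finite_measure (completion M)"
proof -
  obtain A where "countable A" "A \<subseteq> sets M" "\<Union>A = space M" "\<forall>a\<in>A. emeasure M a \<noteq> \<infinity>"
    using assms unfolding sigma_finite_measure_def by blast
  then show ?thesis
    unfolding sigma_finite_measure_def
    by (intro exI[of _ A]) (auto intro: sets_completionI_sets)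
qed

lemma index_measure_sigma_finite: "index_measure M \<Longrightarrow> sigma_finite_measure M"
  unfolding index_measure_def
  by (auto intro!: sigma_finite_measure_count_space_countable sigma_finite_measure_restrict_space
      sigma_finite_completion lborel.sigma_finite_measure_axioms)

text \<open>The letters are the states, and the index of coincidence is bounded for each effect
  \<open>P y\<close>.\<close>

lemma mutual_info_sic_ensemble_le:
  fixes \<rho> P :: "real \<Rightarrow> complex^'d^'d"
  assumes "is_sic_ensemble \<rho>" "is_povm \<nu> P"
  shows "mutual_info (count_space (sic_index CARD('d))) \<rho> \<nu> P \<le> log 2 (2 * real CARD('d) / (real CARD('d) + 1))"
proof -
  let ?d = "real CARD('d)" and ?I = "sic_index CARD('d)"
  interpret sic "1 / ?d\<^sup>2" \<rho>
    using assms(1) by unfold_locales (auto simp: is_sic_ensemble_def)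
  let ?\<mu> = "count_space ?I"
  let ?F = "\<lambda>x y. p_joint \<rho> P x y * log 2 (p_joint \<rho> P x y / (p_input \<rho> x * p_outcome ?\<mu> \<rho> P y))"
  have P: "index_measure \<nu>" "\<And>y. y \<in> space \<nu> \<Longrightarrow> psd (P y)" "has_bochner_integral \<nu> P (mat 1)"
    using assms(2) by (auto simp: is_povm_def is_effect_def)
  have d: "?d \<ge> 1"
    by (simp add: Suc_le_eq)
  have c1: "1 \<le> 2 * ?d / (?d + 1)"
    using d by simp
  have p: "p_joint \<rho> P x y = \<rho> x \<bullet> P y" if "x \<in> ?I" "y \<in> space \<nu>" for x y
    using Re_trace_mult[OF psd_hermitian[OF P(2)[OF that(2)]]] by (simp add: p_joint_def)
  have r: "p_outcome ?\<mu> \<rho> P y = Re (trace (P y)) / ?d" if "y \<in> space \<nu>" for y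
  proof -
    have "average_state ?\<mu> \<rho> = (1 / ?d) *\<^sub>R mat 1"
      using sum_eq by (simp add: average_state_def lebesgue_integral_count_space_finite finite_sic_index power2_eq_square)
    then show ?thesis
      using Re_trace_mult[OF psd_hermitian[OF P(2)[OF that]], of "(1 / ?d) *\<^sub>R mat 1"]
      by (simp add: p_outcome_def inner_commute[of "mat 1"] inner_mat_1)
  qed
  have hbi: "has_bochner_integral \<nu> (\<lambda>y. A \<bullet> P y) (Re (trace A))" for A
    unfolding inner_mat_1[symmetric] by (rule has_bochner_integral_inner_right) (rule P(3))
  show ?thesis
  proof (cases "integrable (?\<mu> \<Otimes>\<^sub>M \<nu>) (\<lambda>(x, y). ?F x y)")
    case True
    note pair = integral_count_space_pair_finite[OF finite_sic_index index_measure_sigma_finite[OF P(1)] True]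
    have "(\<Sum>x\<in>?I. \<integral>y. ?F x y \<partial>\<nu>) \<le> log 2 (2 * ?d / (?d + 1))"
    proof (rule sum_integral_log_ratio_le)
      show "integrable \<nu> (p_joint \<rho> P x)" if "x \<in> ?I" for x
        using hbi[of "\<rho> x"] p[OF that]
        by (subst Bochner_Integration.integrable_cong[OF refl p[OF that]]) (auto simp: has_bochner_integral_iff)
      show "0 \<le> p_joint \<rho> P x y" if "x \<in> ?I" "y \<in> space \<nu>" for x y
        using that P(2) by (simp add: p inner_psd_nonneg)
      show "p_outcome ?\<mu> \<rho> P y = (\<Sum>x\<in>?I. p_joint \<rho> P x y)" if "y \<in> space \<nu>" for y
        using that by (simp add: r p sum_inner power2_eq_square)
      show "(\<integral>y. p_outcome ?\<mu> \<rho> P y \<partial>\<nu>) = 1"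
        using hbi[of "mat 1"]
        by (simp add: r has_bochner_integral_iff inner_commute[of "mat 1"] inner_mat_1 trace_I
            cong: Bochner_Integration.integral_cong)
      show "(\<Sum>x\<in>?I. (p_joint \<rho> P x y)\<^sup>2) \<le> 2 * ?d / (?d + 1) / real (card ?I) * (p_outcome ?\<mu> \<rho> P y)\<^sup>2"
        if "y \<in> space \<nu>" for y
      proof -
        have "2 * (1 / ?d\<^sup>2)\<^sup>2 * ?d / (?d + 1) * t\<^sup>2 = 2 * ?d / (?d + 1) / real (card ?I) * (t / ?d)\<^sup>2" for t
          by (simp add: card_sic_index power2_eq_square)
        then show ?thesis
          using coincidence[OF P(2)[OF that]] that by (simp add: p r)
      qed
      show "p_input \<rho> x = (\<integral>y. p_joint \<rho> P x y \<partial>\<nu>)" if "x \<in> ?I" for x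
        using hbi[of "\<rho> x"] p[OF that]
        by (subst Bochner_Integration.integral_cong[OF refl p[OF that]]) (auto simp: has_bochner_integral_iff p_input_def)
    qed (use pair(1) c1 finite_sic_index in \<open>auto simp: sic_index_def\<close>)
    then show ?thesis
      unfolding mutual_info_def pair(2) .
  next
    \<comment> \<open>The Bochner integral defaults to 0 here, and the bound is nonnegative since
      \<open>2 d / (d + 1) \<ge> 1\<close>. The case split replaces an integrability proof.\<close>
    case False
    then have "mutual_info ?\<mu> \<rho> \<nu> P = 0"
      unfolding mutual_info_def by (rule not_integrable_integral_eq)
    then show ?thesis
      using c1 by simp
  qed
qed

text \<open>Input and output exchange roles: the letters are the outcomes, the index of coincidence
  is bounded for each state \<open>\<rho> x\<close>, and \<open>q\<close> and \<open>r\<close> of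
  the general inequality become the outcome and the input distribution.\<close>

lemma mutual_info_sic_povm_le:
  fixes \<rho> P :: "real \<Rightarrow> complex^'d^'d"
  assumes "is_sic_povm P" "is_ensemble \<mu> \<rho>"
  shows "mutual_info \<mu> \<rho> (count_space (sic_index CARD('d))) P \<le> log 2 (2 * real CARD('d) / (real CARD('d) + 1))"
proof -
  let ?d = "real CARD('d)" and ?I = "sic_index CARD('d)"
  interpret sic "1 / ?d" P
    using assms(1) by unfold_locales (auto simp: is_sic_povm_def)
  let ?\<nu> = "count_space ?I"
  let ?F = "\<lambda>x y. p_joint \<rho> P x y * log 2 (p_joint \<rho> P x y / (p_input \<rho> x * p_outcome \<mu> \<rho> P y))"
  have E: "index_measure \<mu>" "\<rho> \<in> borel_measurable \<mu>" "\<And>x. x \<in> space \<mu> \<Longrightarrow> psd (\<rho> x)"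
      "has_bochner_integral \<mu> (\<lambda>x. Re (trace (\<rho> x))) 1"
    using assms(2) by (auto simp: is_ensemble_def is_state_def)
  have d: "?d \<ge> 1"
    by (simp add: Suc_le_eq)
  have c1: "1 \<le> 2 * ?d / (?d + 1)"
    using d by simp
  have p: "p_joint \<rho> P x y = P y \<bullet> \<rho> x" if "y \<in> ?I" for x y
    using Re_trace_mult[OF psd_hermitian[OF psd[OF that]]] by (simp add: p_joint_def inner_commute)
  \<comment> \<open>An ensemble only comes with an integrable trace; positivity makes the trace
    dominate the norm.\<close>
  have int: "integrable \<mu> \<rho>"
  proof (rule Bochner_Integration.integrable_bound)
    show "integrable \<mu> (\<lambda>x. Re (trace (\<rho> x)))"
      using E(4) by (rule integrable.intros)
    have "norm (\<rho> x) \<le> norm (Re (trace (\<rho> x)))" if "x \<in> space \<mu>" for x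
      using psd_norm_le_trace[OF E(3)[OF that]] by simp
    then show "AE x in \<mu>. norm (\<rho> x) \<le> norm (Re (trace (\<rho> x)))"
      by (rule AE_I2)
  qed (rule E(2))
  have pint: "integrable \<mu> (\<lambda>x. p_joint \<rho> P x y)" if "y \<in> ?I" for y
    using int by (simp add: p[OF that])
  have out: "p_outcome \<mu> \<rho> P y = (\<integral>x. p_joint \<rho> P x y \<partial>\<mu>)" if "y \<in> ?I" for y
    using int Re_trace_mult[OF psd_hermitian[OF psd[OF that]]]
    by (simp add: p[OF that] p_outcome_def average_state_def inner_commute)
  show ?thesis
  proof (cases "integrable (\<mu> \<Otimes>\<^sub>M ?\<nu>) (\<lambda>(x, y). ?F x y)")
    case True
    note pair = integral_pair_count_space_finite[OF finite_sic_index index_measure_sigma_finite[OF E(1)] True]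
    have "(\<Sum>y\<in>?I. \<integral>x. p_joint \<rho> P x y * log 2 (p_joint \<rho> P x y / (p_outcome \<mu> \<rho> P y * p_input \<rho> x)) \<partial>\<mu>) \<le>
        log 2 (2 * ?d / (?d + 1))"
    proof (rule sum_integral_log_ratio_le)
      show "0 \<le> p_joint \<rho> P x y" if "y \<in> ?I" "x \<in> space \<mu>" for x y
        using that E(3) by (simp add: p inner_psd_nonneg)
      show "p_input \<rho> x = (\<Sum>y\<in>?I. p_joint \<rho> P x y)" if "x \<in> space \<mu>" for x
        using that by (simp add: p sum_inner p_input_def)
      show "(\<integral>x. p_input \<rho> x \<partial>\<mu>) = 1"
        using E(4) by (simp add: p_input_def has_bochner_integral_iff)
      show "(\<Sum>y\<in>?I. (p_joint \<rho> P x y)\<^sup>2) \<le> 2 * ?d / (?d + 1) / real (card ?I) * (p_input \<rho> x)\<^sup>2"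
        if "x \<in> space \<mu>" for x
      proof -
        have "2 * (1 / ?d)\<^sup>2 * ?d / (?d + 1) = 2 * ?d / (?d + 1) / real (card ?I)"
          by (simp add: card_sic_index power2_eq_square)
        then show ?thesis
          using coincidence[OF E(3)[OF that]] by (simp add: p p_input_def)
      qed
    qed (use pair(1) c1 finite_sic_index pint out in \<open>auto simp: sic_index_def mult.commute\<close>)
    then show ?thesis
      unfolding mutual_info_def pair(2) by (simp add: mult.commute)
  next
    case False
    then have "mutual_info \<mu> \<rho> ?\<nu> P = 0"
      unfolding mutual_info_def by (rule not_integrable_integral_eq)
    then show ?thesis
      using c1 by simp
  qed
qed

section \<open>Complex Gaussian vectors\<close>

text \<open>Uniqueness of Haar measure by Fubini: integrating
  \<open>indicator A x * indicator B (x + y)\<close> in both orders gives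
  \<open>N A * lborel B = N B * lborel A\<close>. The unit ball is taken for \<open>A\<close>
  because its volume is positive and finite and so can be divided out.\<close>

lemma translation_invariant_eq_lborel:
  fixes N :: "'a::euclidean_space measure"
  assumes sets[measurable_cong]: "sets N = sets borel" and "sigma_finite_measure N"
    and inv: "\<And>a. distr N borel ((+) a) = N"
  obtains c where "N = density lborel (\<lambda>_. c)"
proof -
  interpret N: sigma_finite_measure N by fact
  interpret pair_sigma_finite N lborel ..
  define A :: "'a set" where "A = ball 0 1"
  define v where "v = emeasure lborel A"
  have v: "v \<noteq> 0" "v \<noteq> \<infinity>"
    using unit_ball_vol_pos[of "real DIM('a)"] by (simp_all add: v_def A_def emeasure_ball ennreal_eq_0_iff not_le)
  have [measurable]: "A \<in> sets borel"
    by (simp add: A_def)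
  have key: "emeasure N A * emeasure lborel B = emeasure N B * v" if B[measurable]: "B \<in> sets borel" for B
  proof -
    have "emeasure N A * emeasure lborel B = (\<integral>\<^sup>+x. indicator A x * emeasure lborel B \<partial>N)"
      by (simp add: nn_integral_multc)
    also have "\<dots> = (\<integral>\<^sup>+x. (\<integral>\<^sup>+y. indicator A x * indicator B (x + y) \<partial>lborel) \<partial>N)"
    proof (rule nn_integral_cong)
      fix x
      have "emeasure lborel B = (\<integral>\<^sup>+y. indicator B y \<partial>distr lborel borel ((+) x))"
        by (simp add: lborel_distr_plus)
      also have "\<dots> = (\<integral>\<^sup>+y. indicator B (x + y) \<partial>lborel)"
        by (rule nn_integral_distr) measurable
      finally show "indicator A x * emeasure lborel B = (\<integral>\<^sup>+y. indicator A x * indicator B (x + y) \<partial>lborel)"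
        by (simp add: nn_integral_cmult)
    qed
    also have "\<dots> = (\<integral>\<^sup>+y. (\<integral>\<^sup>+x. indicator A x * indicator B (x + y) \<partial>N) \<partial>lborel)"
      by (rule Fubini'[symmetric]) measurable
    also have "\<dots> = (\<integral>\<^sup>+y. (\<integral>\<^sup>+x. indicator A (x - y) * indicator B x \<partial>N) \<partial>lborel)"
    proof (rule nn_integral_cong)
      fix y
      show "(\<integral>\<^sup>+x. indicator A x * indicator B (x + y) \<partial>N) = (\<integral>\<^sup>+x. indicator A (x - y) * indicator B x \<partial>N)"
        by (subst inv[of "- y", symmetric], subst nn_integral_distr) (simp_all add: algebra_simps)
    qed
    also have "\<dots> = (\<integral>\<^sup>+x. (\<integral>\<^sup>+y. indicator A (x - y) * indicator B x \<partial>lborel) \<partial>N)"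
      by (rule Fubini') measurable
    also have "\<dots> = (\<integral>\<^sup>+x. v * indicator B x \<partial>N)"
    proof (rule nn_integral_cong)
      fix x :: 'a
      have [measurable]: "ball x 1 \<in> sets borel"
        by simp
      have "indicator A (x - y) = (indicator (ball x 1) y :: ennreal)" for y :: 'a
        by (simp add: A_def indicator_def dist_norm norm_minus_commute)
      then have "(\<integral>\<^sup>+y. indicator A (x - y) * indicator B x \<partial>lborel) = (\<integral>\<^sup>+y. indicator (ball x 1) y \<partial>lborel) * indicator B x"
        by (simp add: nn_integral_multc)
      then show "(\<integral>\<^sup>+y. indicator A (x - y) * indicator B x \<partial>lborel) = v * indicator B x"
        by (simp add: v_def A_def emeasure_ball)
    qed
    also have "\<dots> = emeasure N B * v"
      by (simp add: nn_integral_cmult mult.commute)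
    finally show ?thesis .
  qed
  have "N = density lborel (\<lambda>_. emeasure N A / v)"
  proof (rule measure_eqI)
    fix B assume "B \<in> sets N"
    then have B: "B \<in> sets borel"
      by (simp add: sets)
    have "emeasure N B = emeasure N B * v / v"
      using v by (simp add: ennreal_mult_divide_eq)
    also have "\<dots> = emeasure N A / v * emeasure lborel B"
      using key[OF B] by (metis ennreal_times_divide mult.commute)
    finally show "emeasure N B = emeasure (density lborel (\<lambda>_. emeasure N A / v)) B"
      using B by (simp add: emeasure_density_const)
  qed (simp add: sets)
  then show ?thesis
    using that by blast
qed

text \<open>In even dimension the ball of squared radius \<open>a\<close> has the polynomial volume
  \<open>V * a ^ Suc k\<close>; the density is its derivative, and half-lines generate the Borel
  sets.\<close>

lemma distr_norm_square_lborel: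
  assumes dim: "DIM('a::euclidean_space) = 2 * Suc k"
  shows "distr lborel borel (\<lambda>z::'a. (norm z)\<^sup>2) =
    density lborel (\<lambda>t. ennreal (unit_ball_vol DIM('a) * (real (Suc k) * t ^ k)) * indicator {0..} t)"
    (is "?L = ?R")
proof (rule measure_eqI_generator_eq)
  let ?V = "unit_ball_vol DIM('a)"
  have V: "?V \<ge> 0"
    by simp
  have L: "emeasure ?L {..a} = (if a < 0 then 0 else ennreal (?V * a ^ Suc k))" for a
  proof -
    have "emeasure ?L {..a} = emeasure lborel {z::'a. (norm z)\<^sup>2 \<le> a}"
      by (subst emeasure_distr) (auto simp: vimage_def)
    moreover have "{z::'a. (norm z)\<^sup>2 \<le> a} = cball 0 (sqrt a)" if "a \<ge> 0"
      using that by (auto simp: real_le_rsqrt sqrt_ge_absD)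
    moreover have "{z::'a. (norm z)\<^sup>2 \<le> a} = {}" if "a < 0"
      using that by (auto simp: not_le intro: less_le_trans)
    moreover have "sqrt a ^ DIM('a) = a ^ Suc k" if "a \<ge> 0"
      using that by (simp add: dim power_mult)
    ultimately show ?thesis
      by (simp add: emeasure_cball)
  qed
  have R: "emeasure ?R {..a} = (if a < 0 then 0 else ennreal (?V * a ^ Suc k))" for a
  proof -
    have "emeasure ?R {..a} = (\<integral>\<^sup>+t. ennreal (?V * (real (Suc k) * t ^ k)) * indicator {0..a} t \<partial>lborel)"
      by (subst emeasure_density) (auto intro!: nn_integral_cong split: split_indicator)
    also have "\<dots> = (if a < 0 then 0 else ennreal (?V * a ^ Suc k))"
    proof (cases "a < 0")
      case False
      have "(\<integral>\<^sup>+t. ennreal (?V * (real (Suc k) * t ^ k)) * indicator {0..a} t \<partial>lborel) =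
          ennreal (?V * a ^ Suc k - ?V * 0 ^ Suc k)"
      proof (rule nn_integral_FTC_Icc)
        show "((\<lambda>t. ?V * t ^ Suc k) has_real_derivative ?V * (real (Suc k) * t ^ k)) (at t)" for t
          using DERIV_cmult[OF DERIV_pow[of "Suc k" t], of ?V] by (simp del: power_Suc of_nat_Suc)
      qed (use False V in auto)
      with False show ?thesis
        by simp
    qed simp
    finally show ?thesis .
  qed
  show "emeasure ?L X = emeasure ?R X" if "X \<in> range (\<lambda>a::real. {..a})" for X
    using that L R by auto
  show "Int_stable (range (\<lambda>a::real. {..a}))"
    by (auto simp: Int_stable_def)
  show "sets ?L = sigma_sets UNIV (range (\<lambda>a::real. {..a}))"
    by (simp add: borel_eq_atMost)
  show "sets ?R = sigma_sets UNIV (range (\<lambda>a::real. {..a}))"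
    by (simp add: borel_eq_atMost)
  show "range (\<lambda>n::nat. {..real n}) \<subseteq> range (\<lambda>a::real. {..a})" "(\<Union>n::nat. {..real n}) = UNIV"
    by (auto intro: real_arch_simple)
  show "emeasure ?L {..real n} \<noteq> \<infinity>" for n
    by (simp add: L)
qed auto

text \<open>The normalising constant is the total mass of \<open>exp (- (norm z)\<^sup>2)\<close> only for even dimension.\<close>

definition gauss :: "'a::euclidean_space measure" where
  "gauss = density lborel
     (\<lambda>z. ennreal (exp (- (norm z)\<^sup>2) / (unit_ball_vol DIM('a) * fact (DIM('a) div 2))))"

lemma sets_gauss[measurable_cong, simp]: "sets gauss = sets borel"
  and space_gauss[simp]: "space gauss = UNIV"
  by (simp_all add: gauss_def)

text \<open>The Gaussian density is a function of the squared norm, so it can be multiplied in after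
  the image has been taken. The ball volume cancels and a Gamma law of shape \<open>k + 1\<close>
  remains.\<close>

lemma distr_norm_square_gauss:
  assumes dim: "DIM('a::euclidean_space) = 2 * Suc k"
  shows "distr gauss borel (\<lambda>z::'a. (norm z)\<^sup>2) = density lborel (erlang_density k 1)"
proof -
  let ?V = "unit_ball_vol DIM('a)"
  have V: "?V > 0"
    by (simp add: unit_ball_vol_pos)
  let ?g = "\<lambda>t. ennreal (exp (- t) / (?V * fact (Suc k)))"
  have "distr gauss borel (\<lambda>z::'a. (norm z)\<^sup>2) = density (distr lborel borel (\<lambda>z::'a. (norm z)\<^sup>2)) ?g"
    by (subst density_distr) (simp_all add: gauss_def dim)
  also have "\<dots> = density lborel
      (\<lambda>t. ennreal (?V * (real (Suc k) * t ^ k)) * indicator {0..} t * ?g t)"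
    by (subst distr_norm_square_lborel[OF dim], subst density_density_eq) auto
  also have "\<dots> = density lborel (erlang_density k 1)"
  proof (rule density_cong)
    have "?V * (real (Suc k) * t ^ k) * (exp (- t) / (?V * fact (Suc k))) = t ^ k * exp (- t) / fact k" for t
      using V by (simp add: divide_simps less_imp_neq[symmetric])
    then show "AE t in lborel. ennreal (?V * (real (Suc k) * t ^ k)) * indicator {0..} t * ?g t =
        ennreal (erlang_density k 1 t)"
      using V V[THEN less_imp_neq] by (auto simp: erlang_density_def ennreal_mult[symmetric] split: split_indicator)
  qed auto
  finally show ?thesis .
qed

text \<open>The total mass is inherited from the Erlang law of the squared norm, which replaces an
  evaluation of the Gaussian integral.\<close>

lemma prob_space_gauss:
  assumes "DIM('a::euclidean_space) = 2 * Suc k"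
  shows "prob_space (gauss :: 'a measure)"
proof (rule prob_spaceI)
  have "prob_space (density lborel (erlang_density k 1))"
    by (rule prob_space_erlang_density) simp
  then interpret prob_space "distr gauss borel (\<lambda>z::'a. (norm z)\<^sup>2)"
    by (simp add: distr_norm_square_gauss[OF assms])
  show "emeasure (gauss :: 'a measure) (space gauss) = 1"
    using emeasure_space_1 by (simp add: emeasure_distr)
qed

section \<open>Projections of a Gaussian vector\<close>

lemma cdot_add: "cdot v (w + z) = cdot v w + cdot v z"
  by (simp add: cdot_def ring_distribs sum.distrib)

lemma cdot_commute: "cdot w v = cnj (cdot v w)"
  by (simp add: cdot_def mult.commute)

lemma cdot_scale: "cdot v (c *s w) = c * cdot v w"
  by (simp add: cdot_def sum_distrib_left mult_ac)

lemma norm_add_cdot: "(norm (v + w))\<^sup>2 = (norm v)\<^sup>2 + 2 * Re (cdot v w) + (norm w)\<^sup>2"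
proof -
  have "cdot (v + w) (v + w) = cdot v v + (cdot v w + cnj (cdot v w)) + cdot w w"
    by (metis (no_types, lifting) add.assoc cdot_add cdot_commute complex_cnj_add)
  then have "Re (cdot (v + w) (v + w)) = Re (cdot v v + (cdot v w + cnj (cdot v w)) + cdot w w)"
    by (rule arg_cong)
  then show ?thesis
    by (simp add: cdot_self del: of_real_power)
qed

lemma continuous_on_cdot: "continuous_on S (cdot v)"
  unfolding cdot_def[abs_def] by (intro continuous_intros)

lemma measurable_cdot[measurable]: "cdot v \<in> borel_measurable borel"
  by (intro borel_measurable_continuous_onI continuous_on_cdot)

text \<open>
  Removing the component along \<open>v\<close> from the exponent of the Gaussian density makes it invariant
  under the translations along \<open>v\<close>, so its image under \<open>cdot v\<close> is a multiple of Lebesgue measure.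
\<close>

lemma distr_cdot_gauss:
  fixes v :: "complex^'d"
  assumes v: "norm v = 1"
  shows "distr gauss borel (cdot v) = gauss"
proof -
  let ?K = "unit_ball_vol DIM(complex^'d) * fact (DIM(complex^'d) div 2)"
  have K: "?K > 0"
    by (simp add: unit_ball_vol_pos)
  have dim: "DIM(complex^'d) = 2 * Suc (CARD('d) - 1)"
    by simp
  interpret G: prob_space "gauss :: (complex^'d) measure"
    by (rule prob_space_gauss[OF dim])
  \<comment> \<open>The squared length of the component of \<open>z\<close> orthogonal to
    \<open>v\<close>.\<close>
  define e where "e z = (norm z)\<^sup>2 - (cmod (cdot v z))\<^sup>2" for z :: "complex^'d"
  have [measurable]: "e \<in> borel_measurable borel"
    unfolding e_def[abs_def] by measurable
  define M where "M = density lborel (\<lambda>z. ennreal (exp (- e z) / ?K))"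
  define N where "N = distr M borel (cdot v)"
  have sets_M[measurable_cong]: "sets M = sets borel"
    by (simp add: M_def)
  have e_shift: "e (a *s v + z) = e z" for a z
  proof -
    have "cdot v v = 1"
      using v by (simp add: cdot_self)
    then have c: "cdot v (a *s v + z) = a + cdot v z"
      by (simp add: cdot_add cdot_scale)
    have "cdot (a *s v) z = cnj a * cdot v z"
      by (simp add: cdot_def sum_distrib_left mult_ac)
    then have n: "(norm (a *s v + z))\<^sup>2 = (norm (a *s v))\<^sup>2 + 2 * Re (cnj a * cdot v z) + (norm z)\<^sup>2"
      by (simp add: norm_add_cdot)
    have na: "(norm (a *s v))\<^sup>2 = (cmod a)\<^sup>2"
      using v by (simp add: norm_vec_cmod norm_mult power_mult_distrib flip: sum_distrib_left)
         (simp add: norm_vec_cmod[symmetric])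
    show ?thesis
      unfolding e_def c n na by (simp add: cmod_power2) (simp add: power2_eq_square algebra_simps)
  qed
  have M_shift: "distr M borel ((+) (a *s v)) = M" for a
  proof -
    have "distr M borel ((+) (a *s v)) = density (distr lborel borel ((+) (a *s v))) (\<lambda>z. ennreal (exp (- e z) / ?K))"
      by (subst density_distr) (simp_all add: M_def e_shift)
    then show ?thesis
      by (simp add: M_def lborel_distr_plus)
  qed
  have "distr N borel ((+) a) = N" for a
  proof -
    have "distr N borel ((+) a) = distr M borel (\<lambda>z. a + cdot v z)"
      unfolding N_def by (subst distr_distr) (simp_all add: comp_def)
    also have "\<dots> = distr (distr M borel ((+) (a *s v))) borel (cdot v)"
      using v by (subst distr_distr) (simp_all add: comp_def cdot_add cdot_scale cdot_self)
    finally show ?thesis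
      by (simp add: M_shift N_def)
  qed
  moreover have "sigma_finite_measure N"
  proof
    let ?B = "\<lambda>n::nat. ball (0::complex) (real n)"
    \<comment> \<open>\<open>M\<close> itself has infinite mass, but where
      \<open>cmod (cdot v z) < n\<close> its density is at most \<open>exp (n^2)\<close> times the
      Gaussian one.\<close>
    have "emeasure N (?B n) \<noteq> \<infinity>" for n
    proof -
      have "emeasure N (?B n) = (\<integral>\<^sup>+z. ennreal (exp (- e z) / ?K) * indicator (cdot v -` ?B n) z \<partial>lborel)"
        unfolding N_def M_def using measurable_sets[OF measurable_cdot, of "?B n" v]
        by (subst emeasure_distr) (auto simp: emeasure_density)
      also have "\<dots> \<le> (\<integral>\<^sup>+z. ennreal (exp ((real n)\<^sup>2)) * ennreal (exp (- (norm (z :: complex^'d))\<^sup>2) / ?K) \<partial>lborel)"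
      proof (rule nn_integral_mono)
        fix z
        have "exp (- e z) / ?K \<le> exp ((real n)\<^sup>2) * (exp (- (norm z)\<^sup>2) / ?K)" if "cmod (cdot v z) < n"
        proof -
          have "(cmod (cdot v z))\<^sup>2 \<le> (real n)\<^sup>2"
            using that by (intro power_mono) auto
          then have "exp (- e z) \<le> exp ((real n)\<^sup>2) * exp (- (norm z)\<^sup>2)"
            by (simp add: e_def flip: exp_add)
          then show ?thesis
            using K by (simp add: divide_right_mono)
        qed
        then show "ennreal (exp (- e z) / ?K) * indicator (cdot v -` ?B n) z \<le>
            ennreal (exp ((real n)\<^sup>2)) * ennreal (exp (- (norm z)\<^sup>2) / ?K)"
          using K by (auto simp: ennreal_mult[symmetric] split: split_indicator intro!: ennreal_leI)
      qed
      also have "\<dots> = ennreal (exp ((real n)\<^sup>2)) * emeasure (gauss :: (complex^'d) measure) (space gauss)"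
        unfolding gauss_def by (subst emeasure_density) (auto simp: nn_integral_cmult)
      also have "\<dots> < \<infinity>"
        unfolding G.emeasure_space_1 by (simp add: ennreal_mult_less_top)
      finally show ?thesis
        by simp
    qed
    moreover have "(\<Union>n. ?B n) = UNIV"
      by (auto intro: reals_Archimedean2)
    ultimately show "\<exists>A. countable A \<and> A \<subseteq> sets N \<and> \<Union>A = space N \<and> (\<forall>a\<in>A. emeasure N a \<noteq> \<infinity>)"
      by (intro exI[of _ "range ?B"]) (auto simp: N_def)
  qed
  ultimately obtain c where c: "N = density lborel (\<lambda>_. c)"
    using translation_invariant_eq_lborel[of N] by (auto simp: N_def)
  define b where "b w = ennreal (exp (- (cmod w)\<^sup>2))" for w
  have [measurable]: "b \<in> borel_measurable borel"
    unfolding b_def[abs_def] by measurable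
  have "gauss = density M (\<lambda>z. b (cdot v z))"
    unfolding M_def gauss_def b_def using K
    by (subst density_density_eq) (auto simp: e_def ennreal_mult[symmetric] exp_add[symmetric] intro!: density_cong)
  then have "distr gauss borel (cdot v) = density N b"
    unfolding N_def by (subst density_distr) auto
  then have d: "distr gauss borel (cdot v) = density lborel (\<lambda>w. c * b w)"
    unfolding c by (simp add: density_density_eq)
  let ?K1 = "unit_ball_vol DIM(complex) * fact (DIM(complex) div 2)"
  interpret G1: prob_space "gauss :: complex measure"
    by (rule prob_space_gauss[of 0]) simp
  have K1: "?K1 > 0"
    by (simp add: unit_ball_vol_pos)
  have g1: "(gauss :: complex measure) = density lborel (\<lambda>w. ennreal (1 / ?K1) * b w)"
    unfolding gauss_def b_def by (intro density_cong) (auto simp: ennreal_mult[symmetric])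
  interpret D: prob_space "distr gauss borel (cdot v)"
    by (rule G.prob_space_distr) simp
  have "1 = c * (\<integral>\<^sup>+w. b w \<partial>lborel)"
    using D.emeasure_space_1 unfolding d by (simp add: emeasure_density nn_integral_cmult)
  moreover have "1 = ennreal (1 / ?K1) * (\<integral>\<^sup>+w. b w \<partial>lborel)"
    using G1.emeasure_space_1 unfolding g1 by (simp add: emeasure_density nn_integral_cmult)
  \<comment> \<open>Both measures have mass 1. With \<open>B\<close> the integral of
    \<open>b\<close>, \<open>c = c * (1 / ?K1 * B) = 1 / ?K1 * (c * B) = 1 / ?K1\<close>, which
    avoids dividing in \<open>ennreal\<close>.\<close>
  ultimately have "c = ennreal (1 / ?K1)"
    by (metis mult.commute mult.left_commute mult.right_neutral)
  then show ?thesis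
    unfolding d g1 by simp
qed

text \<open>This is the derivative of the Gamma function at \<open>m + 1\<close>.\<close>

definition log_gamma_integral :: "nat \<Rightarrow> real" where
  "log_gamma_integral m = (LBINT t:{0<..}. t ^ m * ln t * exp (- t))"

section \<open>Derivatives of the Gamma function at integers\<close>

lemma set_integrable_power_exp: "set_integrable lborel {0<..} (\<lambda>t::real. t ^ k * exp (- t))"
  and LBINT_power_exp: "(LBINT t:{0<..}. t ^ k * exp (- t)) = (fact k :: real)"
proof -
  have "has_bochner_integral lborel (\<lambda>t. indicator {0<..} t *\<^sub>R (t ^ k * exp (- t)) :: real) (fact k)"
  proof (rule has_bochner_integral_cong_AE[THEN iffD1])
    show "has_bochner_integral lborel (\<lambda>t. t ^ k * exp (- t) * indicator {0..} t :: real) (fact k)"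
      using nn_intergal_power_times_exp_Ici[of k]
      by (intro has_bochner_integral_nn_integral)
         (auto simp: nn_integral_set_ennreal split: split_indicator)
    show "AE t in lborel. t ^ k * exp (- t) * indicator {0..} t = indicator {0<..} t *\<^sub>R (t ^ k * exp (- t) :: real)"
      using AE_lborel_singleton[of "0::real"] by eventually_elim (auto split: split_indicator)
  qed auto
  then show "set_integrable lborel {0<..} (\<lambda>t::real. t ^ k * exp (- t))"
    and "(LBINT t:{0<..}. t ^ k * exp (- t)) = (fact k :: real)"
    unfolding set_integrable_def set_lebesgue_integral_def by (auto simp: has_bochner_integral_iff)
qed

text \<open>\<open>ln u \<le> u - 1\<close> at \<open>u = t\<close> handles large \<open>t\<close>
  and at \<open>u = 1 / t\<close> small \<open>t\<close>; a polynomial bound reduces integrability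
  to the Gamma integrals.\<close>

lemma abs_mult_ln_le: "\<bar>t * ln t\<bar> \<le> 1 + t\<^sup>2" if "t > 0" for t :: real
proof (cases "t \<ge> 1")
  case True
  then have "t * ln t \<le> t * t"
    using ln_le_minus_one[of t] by (intro mult_left_mono) auto
  moreover have "0 \<le> t * ln t"
    using True by simp
  ultimately show ?thesis
    by (simp add: power2_eq_square)
next
  case False
  have "- ln t \<le> 1 / t - 1"
    using ln_le_minus_one[of "1 / t"] that by (simp add: ln_div)
  then have "t * - ln t \<le> t * (1 / t - 1)"
    using that by (intro mult_left_mono) auto
  then have "- (t * ln t) \<le> 1"
    using that by (simp add: right_diff_distrib)
  moreover have "t * ln t \<le> 0"
    using False that by (simp add: mult_le_0_iff)
  ultimately show ?thesis
    by (simp add: abs_if add_increasing2)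
qed

text \<open>One factor \<open>t\<close> is spent on taming \<open>ln t\<close> near 0, hence the
  exponent \<open>Suc m\<close>.\<close>

lemma set_integrable_power_ln_exp: "set_integrable lborel {0<..} (\<lambda>t::real. t ^ Suc m * ln t * exp (- t))"
proof -
  have "set_integrable lborel {0<..} (\<lambda>t::real. t ^ m * exp (- t) + t ^ (m + 2) * exp (- t))"
    by (intro set_integral_add set_integrable_power_exp)
  then show ?thesis
  proof (rule set_integrable_bound)
    show "set_borel_measurable lborel {0<..} (\<lambda>t::real. t ^ Suc m * ln t * exp (- t))"
      unfolding set_borel_measurable_def by measurable
    have "norm (t ^ Suc m * ln t * exp (- t)) \<le> norm (t ^ m * exp (- t) + t ^ (m + 2) * exp (- t))"
      if t: "t > 0" for t :: real
    proof -
      have "norm (t ^ Suc m * ln t * exp (- t)) = t ^ m * exp (- t) * \<bar>t * ln t\<bar>"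
        using t by (simp add: abs_mult)
      also have "\<dots> \<le> t ^ m * exp (- t) * (1 + t\<^sup>2)"
        using t by (intro mult_left_mono abs_mult_ln_le) auto
      also have "\<dots> = t ^ m * exp (- t) + t ^ (m + 2) * exp (- t)"
        by (simp add: algebra_simps power2_eq_square)
      finally show ?thesis
        by simp
    qed
    then have "norm (t ^ Suc m * ln t * exp (- t)) \<le> norm (t ^ m * exp (- t) + t ^ (m + 2) * exp (- t))"
      if "t \<in> {0<..}" for t :: real
      using that by blast
    then show "AE t::real in lborel. t \<in> {0<..} \<longrightarrow> norm (t ^ Suc m * ln t * exp (- t)) \<le> norm (t ^ m * exp (- t) + t ^ (m + 2) * exp (- t))"
      by (intro AE_I2 impI)
  qed
qed

text \<open>The derivative of \<open>\<Gamma>(s + 1) = s \<Gamma>(s)\<close> at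
  \<open>s = m + 2\<close>, proved by integrating by parts.\<close>

lemma log_gamma_integral_rec:
  "log_gamma_integral (Suc (Suc m)) = real (Suc (Suc m)) * log_gamma_integral (Suc m) + fact (Suc m)"
proof -
  let ?n = "Suc m"
  let ?f = "\<lambda>t::real. real (Suc ?n) * (t ^ ?n * ln t * exp (- t)) + t ^ ?n * exp (- t) - t ^ Suc ?n * ln t * exp (- t)"
  let ?F = "\<lambda>t::real. t ^ Suc ?n * ln t * exp (- t)"
  have i: "set_integrable lborel {0<..} (\<lambda>t::real. real (Suc ?n) * (t ^ ?n * ln t * exp (- t)))"
    by (intro set_integrable_mult_right set_integrable_power_ln_exp)
  have int: "set_integrable lborel {0<..} ?f"
    by (intro set_integral_diff set_integral_add i set_integrable_power_ln_exp set_integrable_power_exp)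
  have ei: "einterval 0 \<infinity> = {0::real<..}"
    by (auto simp: einterval_def)
  \<comment> \<open>The two zeros are the limits of \<open>?F\<close> at infinity and at 0.\<close>
  have "(LBINT t=0..\<infinity>. ?f t) = 0 - 0"
  proof (rule interval_integral_FTC_integrable[where F = ?F])
    show "(?F has_vector_derivative ?f t) (at t)" if "0 < ereal t" for t
    proof -
      have t: "t > 0" using that by simp
      have "(?F has_real_derivative (real (Suc ?n) * t ^ ?n * ln t + t ^ Suc ?n * (1 / t)) * exp (- t) - t ^ Suc ?n * ln t * exp (- t)) (at t)"
        by (rule derivative_eq_intros DERIV_pow refl t)+ (simp add: algebra_simps)
      also have "(real (Suc ?n) * t ^ ?n * ln t + t ^ Suc ?n * (1 / t)) * exp (- t) - t ^ Suc ?n * ln t * exp (- t) = ?f t"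
        using t by (simp add: algebra_simps)
      finally show ?thesis
        by (simp add: has_real_derivative_iff_has_vector_derivative)
    qed
    show "isCont ?f t" if "0 < ereal t" for t
      using that by (intro continuous_intros) auto
    show "set_integrable lborel (einterval 0 \<infinity>) ?f"
      unfolding ei by (rule int)
    have "(?F \<longlongrightarrow> 0) (at_right 0)"
      by real_asymp
    then show "((?F \<circ> real_of_ereal) \<longlongrightarrow> 0) (at_right 0)"
      by (simp add: zero_ereal_def ereal_tendsto_simps)
    have "(?F \<longlongrightarrow> 0) at_top"
      by real_asymp
    then show "((?F \<circ> real_of_ereal) \<longlongrightarrow> 0) (at_left \<infinity>)"
      by (simp add: ereal_tendsto_simps)
  qed simp
  then have "(LBINT t:{0<..}. ?f t) = 0"
    by (simp add: interval_lebesgue_integral_def ei)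
  moreover have "(LBINT t:{0<..}. ?f t) =
      real (Suc ?n) * log_gamma_integral ?n + fact ?n - log_gamma_integral (Suc ?n)"
    by (subst set_integral_diff, intro set_integral_add i set_integrable_power_exp, rule set_integrable_power_ln_exp,
        subst set_integral_add, rule i, rule set_integrable_power_exp,
        simp only: log_gamma_integral_def LBINT_power_exp set_integral_mult_right)
  ultimately show ?thesis
    by simp
qed

text \<open>Division by the factorial turns the recursion into that of the digamma function,
  \<open>\<psi>(s + 1) = \<psi>(s) + 1 / s\<close>. The start value
  \<open>log_gamma_integral 1\<close> is kept as it is, since it will cancel.\<close>

lemma log_gamma_integral_harmonic:
  "log_gamma_integral (Suc m) / fact (Suc m) = log_gamma_integral 1 + (\<Sum>n = 2..Suc m. 1 / real n)"
proof (induction m)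
  case (Suc m)
  have "log_gamma_integral (Suc (Suc m)) / fact (Suc (Suc m)) =
      log_gamma_integral (Suc m) / fact (Suc m) + 1 / real (Suc (Suc m))"
    unfolding log_gamma_integral_rec
    by (simp add: add_divide_distrib del: of_nat_Suc fact_Suc) (simp add: fact_Suc[of "Suc m"] del: fact_Suc of_nat_Suc)
  then show ?case
    using Suc by simp
qed simp

section \<open>Gaussian expectations\<close>

lemma gauss_radial:
  fixes h :: "real \<Rightarrow> real"
  assumes dim: "DIM('a::euclidean_space) = 2 * Suc k" and [measurable]: "h \<in> borel_measurable borel"
    and int: "set_integrable lborel {0<..} (\<lambda>t. h t * (t ^ k * exp (- t)))"
  shows "integrable gauss (\<lambda>z::'a. h ((norm z)\<^sup>2))"
    and "integral\<^sup>L gauss (\<lambda>z::'a. h ((norm z)\<^sup>2)) = (LBINT t:{0<..}. h t * (t ^ k * exp (- t))) / fact k"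
proof -
  have AE: "AE t in lborel. erlang_density k 1 t * h t = indicator {0<..} t *\<^sub>R (h t * (t ^ k * exp (- t))) / fact k"
    using AE_lborel_singleton[of "0::real"] by eventually_elim (auto simp: erlang_density_def split: split_indicator)
  have "integrable lborel (\<lambda>t. erlang_density k 1 t * h t)"
    using int unfolding set_integrable_def
    by (subst integrable_cong_AE[OF _ _ AE]) auto
  then have "integrable (distr gauss borel (\<lambda>z::'a. (norm z)\<^sup>2)) h"
    unfolding distr_norm_square_gauss[OF dim] by (subst integrable_real_density) auto
  then show "integrable gauss (\<lambda>z::'a. h ((norm z)\<^sup>2))"
    by (subst (asm) integrable_distr_eq) auto
  have "integral\<^sup>L gauss (\<lambda>z::'a. h ((norm z)\<^sup>2)) = (\<integral>t. h t \<partial>distr gauss borel (\<lambda>z::'a. (norm z)\<^sup>2))"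
    by (subst integral_distr) auto
  also have "\<dots> = (\<integral>t. erlang_density k 1 t * h t \<partial>lborel)"
    unfolding distr_norm_square_gauss[OF dim] by (subst integral_real_density) auto
  also have "\<dots> = (\<integral>t. indicator {0<..} t *\<^sub>R (h t * (t ^ k * exp (- t))) / fact k \<partial>lborel)"
    by (rule integral_cong_AE[OF _ _ AE]) auto
  finally show "integral\<^sup>L gauss (\<lambda>z::'a. h ((norm z)\<^sup>2)) = (LBINT t:{0<..}. h t * (t ^ k * exp (- t))) / fact k"
    by (simp add: set_lebesgue_integral_def)
qed

lemma gauss_norm_square:
  shows "integrable gauss (\<lambda>z::complex^'d. (norm z)\<^sup>2)"
    and "integrable gauss (\<lambda>z::complex^'d. (norm z)\<^sup>2 * ln ((norm z)\<^sup>2))"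
    and "integral\<^sup>L gauss (\<lambda>z::complex^'d. (norm z)\<^sup>2 * ln ((norm z)\<^sup>2)) =
      real CARD('d) * (log_gamma_integral CARD('d) / fact CARD('d))"
proof -
  define k where "k = CARD('d) - 1"
  have Sk: "CARD('d) = Suc k"
    by (simp add: k_def)
  have dim: "DIM(complex^'d) = 2 * Suc k"
    by (simp add: Sk)
  have 1: "(\<lambda>t::real. t * (t ^ k * exp (- t))) = (\<lambda>t. t ^ Suc k * exp (- t))"
    by (simp add: mult_ac)
  have 2: "(\<lambda>t::real. t * ln t * (t ^ k * exp (- t))) = (\<lambda>t. t ^ Suc k * ln t * exp (- t))"
    by (simp add: mult_ac)
  show "integrable gauss (\<lambda>z::complex^'d. (norm z)\<^sup>2)"
    by (rule gauss_radial[OF dim, of "\<lambda>t. t"]) (simp_all add: 1 set_integrable_power_exp del: power_Suc)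
  show "integrable gauss (\<lambda>z::complex^'d. (norm z)\<^sup>2 * ln ((norm z)\<^sup>2))"
    by (rule gauss_radial[OF dim, of "\<lambda>t. t * ln t"]) (simp_all add: 2 set_integrable_power_ln_exp del: power_Suc)
  have "integral\<^sup>L gauss (\<lambda>z::complex^'d. (norm z)\<^sup>2 * ln ((norm z)\<^sup>2)) = log_gamma_integral (Suc k) / fact k"
    unfolding log_gamma_integral_def
    by (subst gauss_radial[OF dim, of "\<lambda>t. t * ln t"]) (simp_all add: 2 set_integrable_power_ln_exp del: power_Suc)
  \<comment> \<open>Passing from \<open>fact k\<close> to \<open>fact (Suc k)\<close> in the
    denominator produces the factor \<open>CARD('d)\<close>.\<close>
  then show "integral\<^sup>L gauss (\<lambda>z::complex^'d. (norm z)\<^sup>2 * ln ((norm z)\<^sup>2)) =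
      real CARD('d) * (log_gamma_integral CARD('d) / fact CARD('d))"
    by (simp add: Sk del: of_nat_Suc)
qed

text \<open>The projection is a standard complex Gaussian, so its squared modulus is exponentially
  distributed: the radial formula in complex dimension 1.\<close>

lemma gauss_cdot:
  fixes v :: "complex^'d"
  assumes "norm v = 1"
  shows "integrable gauss (\<lambda>z. (cmod (cdot v z))\<^sup>2)"
    and "(\<integral>z. (cmod (cdot v z))\<^sup>2 \<partial>gauss) = 1"
    and "integrable gauss (\<lambda>z. (cmod (cdot v z))\<^sup>2 * ln ((cmod (cdot v z))\<^sup>2))"
    and "(\<integral>z. (cmod (cdot v z))\<^sup>2 * ln ((cmod (cdot v z))\<^sup>2) \<partial>gauss) = log_gamma_integral 1"
proof -
  have *: "integrable gauss (\<lambda>z. h ((cmod (cdot v z))\<^sup>2)) \<and>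
      (\<integral>z. h ((cmod (cdot v z))\<^sup>2) \<partial>gauss) = (LBINT t:{0<..}. h t * (t ^ 0 * exp (- t))) / fact 0"
    if [measurable]: "h \<in> borel_measurable borel" and "set_integrable lborel {0<..} (\<lambda>t. h t * (t ^ 0 * exp (- t)))"
    for h :: "real \<Rightarrow> real"
  proof -
    have dim: "DIM(complex) = 2 * Suc 0"
      by simp
    have "integrable (distr gauss borel (cdot v)) (\<lambda>w. h ((cmod w)\<^sup>2))"
      "(\<integral>w. h ((cmod w)\<^sup>2) \<partial>distr gauss borel (cdot v)) = (LBINT t:{0<..}. h t * (t ^ 0 * exp (- t))) / fact 0"
      unfolding distr_cdot_gauss[OF assms] using gauss_radial[OF dim that] by auto
    then show ?thesis
      by (simp_all add: integrable_distr_eq integral_distr)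
  qed
  have i1: "set_integrable lborel {0<..} (\<lambda>t::real. t * (t ^ 0 * exp (- t)))"
    using set_integrable_power_exp[of 1] by simp
  have i2: "set_integrable lborel {0<..} (\<lambda>t::real. t * ln t * (t ^ 0 * exp (- t)))"
    using set_integrable_power_ln_exp[of 0] by simp
  show "integrable gauss (\<lambda>z. (cmod (cdot v z))\<^sup>2)" "(\<integral>z. (cmod (cdot v z))\<^sup>2 \<partial>gauss) = 1"
    using *[OF _ i1] LBINT_power_exp[of 1] by simp_all
  show "integrable gauss (\<lambda>z. (cmod (cdot v z))\<^sup>2 * ln ((cmod (cdot v z))\<^sup>2))"
    "(\<integral>z. (cmod (cdot v z))\<^sup>2 * ln ((cmod (cdot v z))\<^sup>2) \<partial>gauss) = log_gamma_integral 1"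
    using *[OF _ i2] by (simp_all add: log_gamma_integral_def)
qed

lemma continuous_on_outer: "continuous_on S outer"
  unfolding outer_def[abs_def] by (intro continuous_intros continuous_on_vec_lambda)

lemma measurable_outer[measurable]: "outer \<in> borel_measurable borel"
  by (intro borel_measurable_continuous_onI continuous_on_outer)

lemma norm_outer_le: "norm (outer v) \<le> (norm v)\<^sup>2"
  using psd_norm_le_trace[OF psd_outer, of v] by (simp add: trace_outer del: of_real_power)

text \<open>The mean is identified through its quadratic form: at a unit vector \<open>v\<close> it
  is the expectation of \<open>(cmod (cdot v z))^2\<close>, which is 1.\<close>

lemma gauss_outer: "has_bochner_integral gauss (outer :: complex^'d \<Rightarrow> _) (mat 1)"
proof -
  let ?A = "integral\<^sup>L gauss (outer :: complex^'d \<Rightarrow> _)"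
  have int: "integrable gauss (outer :: complex^'d \<Rightarrow> _)"
  proof (rule Bochner_Integration.integrable_bound[OF gauss_norm_square(1)])
    show "AE z::complex^'d in gauss. norm (outer z) \<le> norm ((norm z)\<^sup>2)"
      using norm_outer_le by (intro AE_I2) simp
  qed simp
  have "hermitian ?A"
    by (rule hermitian_integral[OF int psd_hermitian[OF psd_outer]])
  moreover have "hermitian (mat 1 :: complex^'d^'d)"
    by (simp add: hermitian_def mat_def)
  moreover have "Re (qform ?A v) = Re (qform (mat 1) v)" if v: "norm v = 1" for v
  proof -
    have "Re (qform ?A v) = (\<integral>z. outer v \<bullet> outer z \<partial>gauss)"
      using int by (simp add: inner_outer_eq_qform[symmetric])
    also have "\<dots> = 1"
      using gauss_cdot(2)[OF v] by (simp add: inner_outer)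
    also have "\<dots> = Re (qform (mat 1) v)"
      using v by (simp add: inner_outer_eq_qform[symmetric] inner_mat_1 trace_outer)
    finally show ?thesis .
  qed
  ultimately have "?A = mat 1"
    by (rule hermitian_eqI_qform)
  with int show ?thesis
    by (simp add: has_bochner_integral_iff)
qed

section \<open>Finite approximation of a POVM\<close>

text \<open>A partition is encoded by a label \<open>k\<close> with values in \<open>nat\<close>;
  measurability of all its cells is then one measurability statement about \<open>k\<close>.\<close>

definition cell :: "('a \<Rightarrow> nat) \<Rightarrow> nat \<Rightarrow> 'a \<Rightarrow> real" where
  "cell k i z = (if k z = i then 1 else 0)"

lemma cell_nonneg: "0 \<le> cell k i z"
  by (simp add: cell_def)

lemma sum_cell: "k z < n \<Longrightarrow> (\<Sum>i<n. cell k i z) = 1"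
  by (simp add: cell_def)

lemma integrable_cell:
  fixes f :: "'a \<Rightarrow> 'b::{banach, second_countable_topology}"
  assumes [measurable]: "k \<in> measurable M (count_space UNIV)" and f: "integrable M f"
  shows "integrable M (\<lambda>z. cell k i z *\<^sub>R f z)"
proof (rule Bochner_Integration.integrable_bound[OF f])
  have [measurable]: "f \<in> borel_measurable M"
    using f by auto
  show "(\<lambda>z. cell k i z *\<^sub>R f z) \<in> borel_measurable M"
    unfolding cell_def by measurable
qed (simp add: cell_def)

lemma sum_integral_cell:
  fixes f :: "'a \<Rightarrow> 'b::{banach, second_countable_topology}"
  assumes k: "k \<in> measurable M (count_space UNIV)" and f: "integrable M f"
    and n: "\<And>z. z \<in> space M \<Longrightarrow> k z < n"
  shows "(\<Sum>i<n. \<integral>z. cell k i z *\<^sub>R f z \<partial>M) = integral\<^sup>L M f"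
proof -
  have "(\<Sum>i<n. \<integral>z. cell k i z *\<^sub>R f z \<partial>M) = (\<integral>z. (\<Sum>i<n. cell k i z *\<^sub>R f z) \<partial>M)"
    using integrable_cell[OF k f] by (simp add: Bochner_Integration.integral_sum)
  also have "\<dots> = integral\<^sup>L M f"
    using n by (intro Bochner_Integration.integral_cong refl) (simp add: sum_cell flip: scaleR_sum_left)
  finally show ?thesis .
qed

text \<open>
  For \<open>\<eta> t = t ln t\<close>, lumping together the points of a cell on which the likelihood ratio \<open>g\<close> hardly
  varies hardly lowers the information.
\<close>

lemma coarse_graining_loss:
  fixes r g :: "'a \<Rightarrow> real" and \<eta> :: "real \<Rightarrow> real"
  assumes k: "k \<in> measurable M (count_space UNIV)" and n: "\<And>z. z \<in> space M \<Longrightarrow> k z < n"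
    and r: "integrable M r" "\<And>z. z \<in> space M \<Longrightarrow> 0 \<le> r z"
    and rg: "integrable M (\<lambda>z. r z * g z)" and r\<eta>: "integrable M (\<lambda>z. r z * \<eta> (g z))"
    and g: "\<And>z. z \<in> space M \<Longrightarrow> g z \<in> {0..b}"
    and osc: "\<And>z w. z \<in> space M \<Longrightarrow> w \<in> space M \<Longrightarrow> k z = k w \<Longrightarrow> \<bar>g z - g w\<bar> \<le> \<delta>"
    and \<eta>: "\<And>s t. s \<in> {0..b} \<Longrightarrow> t \<in> {0..b} \<Longrightarrow> \<bar>s - t\<bar> \<le> \<delta> \<Longrightarrow> \<bar>\<eta> s - \<eta> t\<bar> \<le> \<epsilon>"
  shows "(\<integral>z. r z * \<eta> (g z) \<partial>M) - \<epsilon> * (\<integral>z. r z \<partial>M) \<le>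
    (\<Sum>i<n. (\<integral>z. cell k i z * r z \<partial>M) *
      \<eta> ((\<integral>z. cell k i z * (r z * g z) \<partial>M) / (\<integral>z. cell k i z * r z \<partial>M)))"
proof -
  define R where "R i = (\<integral>z. cell k i z * r z \<partial>M)" for i
  define G where "G i = (\<integral>z. cell k i z * (r z * g z) \<partial>M)" for i
  have ir: "integrable M (\<lambda>z. cell k i z * r z)" for i
    using integrable_cell[OF k r(1)] by simp
  have ig: "integrable M (\<lambda>z. cell k i z * (r z * g z))" for i
    using integrable_cell[OF k rg] by simp
  have i\<eta>: "integrable M (\<lambda>z. cell k i z * (r z * \<eta> (g z)))" for i
    using integrable_cell[OF k r\<eta>] by simp
  have bound: "(\<integral>z. cell k i z * (r z * \<eta> (g z)) \<partial>M) - \<epsilon> * R i \<le> R i * \<eta> (G i / R i)" for i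
  proof (cases "R i = 0")
    case True
    have nn: "AE z in M. 0 \<le> cell k i z * r z"
    proof (rule AE_I2)
      show "0 \<le> cell k i z * r z" if "z \<in> space M" for z
        using r(2)[OF that] cell_nonneg[of k i z] by simp
    qed
    have "AE z in M. cell k i z * r z = 0"
      using True unfolding R_def integral_nonneg_eq_0_iff_AE[OF ir nn] .
    then have "(\<integral>z. cell k i z * (r z * \<eta> (g z)) \<partial>M) = 0"
      by (intro integral_eq_zero_AE) auto
    then show ?thesis
      using True by simp
  next
    case False
    have "R i \<ge> 0"
      unfolding R_def using r(2) cell_nonneg by (intro integral_nonneg_AE AE_I2 mult_nonneg_nonneg) auto
    with False have R: "R i > 0"
      by simp
    \<comment> \<open>The mean of \<open>g\<close> over the cell with weight \<open>r\<close>. It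
      lies in \<open>{0..b}\<close> and within \<open>\<delta>\<close> of every value of
      \<open>g\<close> on the cell, so the modulus of continuity of \<open>\<eta>\<close> controls
      the loss.\<close>
    let ?m = "G i / R i"
    have "0 \<le> G i"
      unfolding G_def using r(2) g cell_nonneg by (intro integral_nonneg_AE AE_I2 mult_nonneg_nonneg) auto
    moreover have "G i \<le> (\<integral>z. b * (cell k i z * r z) \<partial>M)"
      unfolding G_def
    proof (rule integral_mono)
      fix z assume z: "z \<in> space M"
      have "g z * (cell k i z * r z) \<le> b * (cell k i z * r z)"
        using g[OF z] r(2)[OF z] cell_nonneg[of k i z] by (intro mult_right_mono) auto
      then show "cell k i z * (r z * g z) \<le> b * (cell k i z * r z)"
        by (simp add: mult_ac)
    qed (use ir ig in auto)
    ultimately have m: "?m \<in> {0..b}"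
      using R by (simp add: R_def divide_le_eq)
    have near: "\<bar>?m - g z\<bar> \<le> \<delta>" if z: "z \<in> space M" "k z = i" for z
    proof -
      have "G i - g z * R i = (\<integral>w. cell k i w * (r w * g w) - g z * (cell k i w * r w) \<partial>M)"
        using ir ig by (simp add: G_def R_def)
      also have "\<bar>\<dots>\<bar> \<le> (\<integral>w. \<bar>cell k i w * (r w * g w) - g z * (cell k i w * r w)\<bar> \<partial>M)"
        by (rule integral_abs_bound)
      also have "\<dots> \<le> (\<integral>w. \<delta> * (cell k i w * r w) \<partial>M)"
      proof (rule integral_mono)
        fix w assume w: "w \<in> space M"
        have "\<bar>cell k i w * (r w * g w) - g z * (cell k i w * r w)\<bar> = \<bar>g w - g z\<bar> * (cell k i w * r w)"
          using r(2)[OF w] cell_nonneg[of k i w] by (simp add: cell_def abs_mult left_diff_distrib[symmetric] mult.commute[of "r w"])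
        also have "\<dots> \<le> \<delta> * (cell k i w * r w)"
          using osc[OF w z(1)] z(2) r(2)[OF w] by (auto simp: cell_def intro!: mult_right_mono)
        finally show "\<bar>cell k i w * (r w * g w) - g z * (cell k i w * r w)\<bar> \<le> \<delta> * (cell k i w * r w)" .
      qed (use ir ig in auto)
      also have "\<dots> = \<delta> * R i"
        using ir by (simp add: R_def)
      finally have "\<bar>G i - g z * R i\<bar> / R i \<le> \<delta>"
        using R by (simp add: divide_le_eq)
      moreover have "\<bar>G i - g z * R i\<bar> / R i = \<bar>?m - g z\<bar>"
      proof -
        have "?m - g z = (G i - g z * R i) / R i"
          using R by (simp add: diff_divide_distrib)
        then show ?thesis
          using R by (simp only: abs_divide abs_of_pos)
      qed
      ultimately show ?thesis
        by simp
    qed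
    have "(\<integral>z. cell k i z * (r z * \<eta> (g z)) \<partial>M) \<le> (\<integral>z. (\<eta> ?m + \<epsilon>) * (cell k i z * r z) \<partial>M)"
    proof (rule integral_mono)
      fix z assume z: "z \<in> space M"
      show "cell k i z * (r z * \<eta> (g z)) \<le> (\<eta> ?m + \<epsilon>) * (cell k i z * r z)"
      proof (cases "k z = i")
        case True
        have "\<eta> (g z) \<le> \<eta> ?m + \<epsilon>"
          using \<eta>[OF m g[OF z] near[OF z True]] by linarith
        then have "\<eta> (g z) * r z \<le> (\<eta> ?m + \<epsilon>) * r z"
          using r(2)[OF z] by (rule mult_right_mono)
        then show ?thesis
          using True by (simp add: cell_def mult.commute)
      qed (simp add: cell_def)
    qed (use ir i\<eta> in auto)
    also have "\<dots> = (\<eta> ?m + \<epsilon>) * R i"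
      by (simp add: R_def)
    finally show ?thesis
      by (simp add: algebra_simps)
  qed
  have sR: "(\<Sum>i<n. R i) = (\<integral>z. r z \<partial>M)"
    using sum_integral_cell[OF k r(1) n] by (simp add: R_def)
  have s\<eta>: "(\<Sum>i<n. \<integral>z. cell k i z * (r z * \<eta> (g z)) \<partial>M) = (\<integral>z. r z * \<eta> (g z) \<partial>M)"
    using sum_integral_cell[OF k r\<eta> n] by simp
  have "(\<integral>z. r z * \<eta> (g z) \<partial>M) - \<epsilon> * (\<integral>z. r z \<partial>M) =
      (\<Sum>i<n. (\<integral>z. cell k i z * (r z * \<eta> (g z)) \<partial>M) - \<epsilon> * R i)"
    by (simp add: sum_subtractf s\<eta> sR flip: sum_distrib_left)
  also have "\<dots> \<le> (\<Sum>i<n. R i * \<eta> (G i / R i))"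
    by (intro sum_mono bound)
  finally show ?thesis
    by (simp add: R_def G_def)
qed

text \<open>Total boundedness of the unit ball gives finitely many centres; labelling a point by the
  least index of a centre closer than \<open>\<delta> / 2\<close> makes the cells disjoint and the
  label measurable.\<close>

lemma finite_cells:
  fixes s :: "'a \<Rightarrow> 'b::euclidean_space"
  assumes [measurable]: "s \<in> borel_measurable M" and s: "\<And>z. z \<in> space M \<Longrightarrow> norm (s z) \<le> 1" and "\<delta> > 0"
  obtains k and n :: nat where "k \<in> measurable M (count_space UNIV)" "\<And>z. z \<in> space M \<Longrightarrow> k z < n"
    "\<And>z w. z \<in> space M \<Longrightarrow> w \<in> space M \<Longrightarrow> k z = k w \<Longrightarrow> norm (s z - s w) \<le> \<delta>"
proof -
  have "\<exists>C. finite C \<and> cball (0::'b) 1 \<subseteq> (\<Union>c\<in>C. ball c (\<delta> / 2))"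
    using compact_cball[of "0::'b" 1] \<open>\<delta> > 0\<close> unfolding compact_eq_totally_bounded
    by (metis half_gt_zero)
  then obtain C where C: "finite C" "cball (0::'b) 1 \<subseteq> (\<Union>c\<in>C. ball c (\<delta> / 2))"
    by blast
  obtain cs where cs: "set cs = C"
    using finite_list[OF C(1)] by blast
  define k where "k z = (LEAST i. i < length cs \<and> dist (cs ! i) (s z) < \<delta> / 2)" for z
  have k: "k z < length cs \<and> dist (cs ! k z) (s z) < \<delta> / 2" if "z \<in> space M" for z
    unfolding k_def
  proof (rule LeastI_ex)
    have "s z \<in> cball 0 1"
      using s[OF that] by simp
    then obtain c where "c \<in> set cs" "s z \<in> ball c (\<delta> / 2)"
      using C(2) cs by blast
    then show "\<exists>i<length cs. dist (cs ! i) (s z) < \<delta> / 2"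
      by (auto simp: in_set_conv_nth)
  qed
  show ?thesis
  proof (rule that)
    show "k \<in> measurable M (count_space UNIV)"
      unfolding k_def[abs_def] by measurable
    show "k z < length cs" if "z \<in> space M" for z
      using k[OF that] by blast
    show "norm (s z - s w) \<le> \<delta>" if "z \<in> space M" "w \<in> space M" "k z = k w" for z w
    proof -
      have "dist (s z) (s w) \<le> dist (cs ! k z) (s z) + dist (cs ! k z) (s w)"
        by (rule dist_triangle3)
      then show ?thesis
        using k[OF that(1)] k[OF that(2)] that(3) by (simp add: dist_norm)
    qed
  qed
qed

text \<open>The value at 0 is 0 thanks to the factor \<open>t\<close>, and this agrees with the
  limit from the right.\<close>

lemma continuous_on_mult_ln: "continuous_on {0..} (\<lambda>t::real. t * ln t)"
proof -
  have "((\<lambda>t::real. t * ln t) \<longlongrightarrow> 0 * ln 0) (at_right 0)"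
    by simp real_asymp
  then have "((\<lambda>t::real. t * ln t) \<longlongrightarrow> 0 * ln 0) (at 0 within {0..})"
    by (simp only: at_within_Ici_at_right)
  moreover have "((\<lambda>t::real. t * ln t) \<longlongrightarrow> x * ln x) (at x within {0..})" if "x > 0" for x
    using that by (intro tendsto_intros) auto
  ultimately show ?thesis
    unfolding continuous_on_def by (metis atLeast_iff order_le_less)
qed

text \<open>The cells partition the normalised operators rather than the likelihoods of a particular
  \<open>x\<close>. Since the \<open>W x\<close> are uniformly bounded, one partition works for all
  \<open>x\<close>, which is needed to obtain a single POVM.\<close>

lemma finite_povm_approximation:
  fixes Q :: "'a \<Rightarrow> complex^'d^'d" and W :: "'i \<Rightarrow> complex^'d^'d"
  assumes Q: "has_bochner_integral M Q (mat 1)" and psd: "\<And>z. z \<in> space M \<Longrightarrow> psd (Q z)"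
    and W: "\<And>x. x \<in> A \<Longrightarrow> norm (W x) \<le> b"
    and W_psd: "\<And>x B. x \<in> A \<Longrightarrow> psd B \<Longrightarrow> 0 \<le> W x \<bullet> B"
    and e: "\<epsilon> > 0"
  obtains n :: nat and T :: "nat \<Rightarrow> complex^'d^'d" where
    "\<And>i. psd (T i)" "(\<Sum>i<n. T i) = mat 1"
    "\<And>x. x \<in> A \<Longrightarrow> (\<integral>z. W x \<bullet> Q z * ln (W x \<bullet> Q z / Re (trace (Q z))) \<partial>M) - \<epsilon> * real CARD('d) \<le>
      (\<Sum>i<n. W x \<bullet> T i * ln (W x \<bullet> T i / Re (trace (T i))))"
proof -
  define \<eta> where "\<eta> t = t * ln t" for t :: real
  define r where "r z = Re (trace (Q z))" for z
  define s where "s z = (1 / r z) *\<^sub>R Q z" for z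
  \<comment> \<open>A strictly positive bound, because the cell diameter is
    \<open>\<delta> / (2 * B)\<close>.\<close>
  define B where "B = \<bar>b\<bar> + 1"
  have B: "B > 0" "b \<le> B"
    by (auto simp: B_def)
  have Qint: "integrable M Q" and Q1: "integral\<^sup>L M Q = mat 1"
    using Q by (auto simp: has_bochner_integral_iff)
  have r_eq: "r z = Q z \<bullet> mat 1" for z
    by (simp add: r_def inner_mat_1)
  have rint: "integrable M r"
    unfolding r_eq[abs_def] using Qint by simp
  have "integral\<^sup>L M r = integral\<^sup>L M Q \<bullet> mat 1"
    unfolding r_eq[abs_def] using Qint by simp
  then have r1: "integral\<^sup>L M r = real CARD('d)"
    by (simp add: Q1 inner_mat_1 trace_I)
  have rnn: "0 \<le> r z" if "z \<in> space M" for z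
    using psd_trace_nonneg[OF psd[OF that]] by (simp add: r_def)
  have [measurable]: "Q \<in> borel_measurable M" "r \<in> borel_measurable M"
    using Qint rint by auto
  have sm[measurable]: "s \<in> borel_measurable M"
    unfolding s_def[abs_def] by measurable
  have s1: "norm (s z) \<le> 1" if "z \<in> space M" for z
    using psd_norm_le_trace[OF psd[OF that]] rnn[OF that] by (simp add: s_def r_def divide_le_eq)
  \<comment> \<open>Where the trace is 0, \<open>s z\<close> defaults to 0, and so does
    \<open>Q z\<close> by positivity.\<close>
  have rs: "r z *\<^sub>R s z = Q z" if "z \<in> space M" for z
    using psd_norm_le_trace[OF psd[OF that]] by (cases "r z = 0") (auto simp: s_def r_def)
  have spsd: "psd (s z)" if "z \<in> space M" for z
    unfolding s_def using rnn[OF that] psd[OF that] by (intro psd_scaleR) auto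
  have cont: "continuous_on {0..B} \<eta>"
    unfolding \<eta>_def[abs_def] by (rule continuous_on_subset[OF continuous_on_mult_ln]) auto
  then have "uniformly_continuous_on {0..B} \<eta>"
    by (intro compact_uniformly_continuous) auto
  then obtain \<delta> where \<delta>: "\<delta> > 0"
    "\<And>u t. u \<in> {0..B} \<Longrightarrow> t \<in> {0..B} \<Longrightarrow> dist t u < \<delta> \<Longrightarrow> dist (\<eta> t) (\<eta> u) < \<epsilon>"
    using e unfolding uniformly_continuous_on_def by meson
  obtain C where C: "\<And>t. t \<in> {0..B} \<Longrightarrow> \<bar>\<eta> t\<bar> \<le> C"
    using compact_imp_bounded[OF compact_continuous_image[OF cont compact_Icc]]
    unfolding bounded_iff by (metis image_eqI real_norm_def)
  obtain k and n :: nat where k: "k \<in> measurable M (count_space UNIV)" "\<And>z. z \<in> space M \<Longrightarrow> k z < n"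
    "\<And>z w. z \<in> space M \<Longrightarrow> w \<in> space M \<Longrightarrow> k z = k w \<Longrightarrow> norm (s z - s w) \<le> \<delta> / (2 * B)"
    by (rule finite_cells[OF sm s1, of "\<delta> / (2 * B)"]) (use \<delta>(1) B in auto)
  define T where "T i = (\<integral>z. cell k i z *\<^sub>R Q z \<partial>M)" for i
  have Tint: "integrable M (\<lambda>z. cell k i z *\<^sub>R Q z)" for i
    by (rule integrable_cell[OF k(1) Qint])
  show ?thesis
  proof (rule that)
    show "psd (T i)" for i
      unfolding T_def using psd cell_nonneg[of k i] by (intro psd_integral Tint psd_scaleR)
    show "(\<Sum>i<n. T i) = mat 1"
      using sum_integral_cell[OF k(1) Qint k(2)] by (simp add: T_def Q1)
    fix x assume x: "x \<in> A"
    define g where "g z = W x \<bullet> s z" for z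
    have rg: "r z * g z = W x \<bullet> Q z" if "z \<in> space M" for z
      unfolding g_def rs[OF that, symmetric] by simp
    have gB: "g z \<in> {0..B}" if "z \<in> space M" for z
    proof -
      have "g z \<le> norm (W x) * norm (s z)"
        unfolding g_def by (rule norm_cauchy_schwarz)
      also have "\<dots> \<le> B * 1"
        using W[OF x] B s1[OF that] by (intro mult_mono) auto
      finally show ?thesis
        using W_psd[OF x spsd[OF that]] by (simp add: g_def)
    qed
    have [measurable]: "g \<in> borel_measurable M"
      unfolding g_def[abs_def] by measurable
    have rgint: "integrable M (\<lambda>z. r z * g z)"
      using Qint by (subst Bochner_Integration.integrable_cong[OF refl rg]) auto
    have r\<eta>int: "integrable M (\<lambda>z. r z * \<eta> (g z))"
    proof (rule Bochner_Integration.integrable_bound)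
      show "integrable M (\<lambda>z. C * r z)"
        using rint by simp
      have "norm (r z * \<eta> (g z)) \<le> norm (C * r z)" if z: "z \<in> space M" for z
      proof -
        have "norm (r z * \<eta> (g z)) \<le> r z * C"
          using C[OF gB[OF z]] rnn[OF z] by (simp add: abs_mult mult_left_mono)
        also have "\<dots> \<le> norm (C * r z)"
          by (simp add: mult.commute)
        finally show ?thesis .
      qed
      then show "AE z in M. norm (r z * \<eta> (g z)) \<le> norm (C * r z)"
        by (rule AE_I2)
    qed (simp add: \<eta>_def)
    have osc: "\<bar>g z - g w\<bar> \<le> \<delta> / 2" if "z \<in> space M" "w \<in> space M" "k z = k w" for z w
    proof -
      have "\<bar>g z - g w\<bar> \<le> norm (W x) * norm (s z - s w)"
        unfolding g_def inner_diff_right[symmetric] by (rule Cauchy_Schwarz_ineq2)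
      also have "\<dots> \<le> B * (\<delta> / (2 * B))"
        using W[OF x] B k(3)[OF that] by (intro mult_mono) auto
      finally show ?thesis
        using B by simp
    qed
    \<comment> \<open>Uniform continuity asks for a distance strictly below \<open>\<delta>\<close>,
      hence the halved oscillation.\<close>
    have \<eta>': "\<bar>\<eta> u - \<eta> t\<bar> \<le> \<epsilon>" if "u \<in> {0..B}" "t \<in> {0..B}" "\<bar>u - t\<bar> \<le> \<delta> / 2" for u t
      using \<delta>(2)[OF that(2,1)] that(3) \<delta>(1) by (simp add: dist_real_def)
    have cr: "(\<integral>z. cell k i z * r z \<partial>M) = Re (trace (T i))" for i
    proof -
      have "(\<integral>z. cell k i z * r z \<partial>M) = (\<integral>z. (cell k i z *\<^sub>R Q z) \<bullet> mat 1 \<partial>M)"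
        by (simp add: r_eq)
      also have "\<dots> = T i \<bullet> mat 1"
        unfolding T_def by (rule integral_inner_left) (rule Tint)
      finally show ?thesis
        by (simp add: inner_mat_1)
    qed
    have crg: "(\<integral>z. cell k i z * (r z * g z) \<partial>M) = W x \<bullet> T i" for i
    proof -
      have "(\<integral>z. cell k i z * (r z * g z) \<partial>M) = (\<integral>z. W x \<bullet> (cell k i z *\<^sub>R Q z) \<partial>M)"
        by (intro Bochner_Integration.integral_cong) (auto simp: rg)
      also have "\<dots> = W x \<bullet> T i"
        unfolding T_def by (rule integral_inner_right) (rule Tint)
      finally show ?thesis .
    qed
    have T0: "T i = 0" if "Re (trace (T i)) = 0" for i
      using psd_norm_le_trace[OF \<open>psd (T i)\<close>] that by simp
    have "(\<integral>z. W x \<bullet> Q z * ln (W x \<bullet> Q z / Re (trace (Q z))) \<partial>M) = (\<integral>z. r z * \<eta> (g z) \<partial>M)"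
      by (intro Bochner_Integration.integral_cong) (auto simp: \<eta>_def rg[symmetric] r_def[symmetric])
    moreover have "(\<integral>z. r z * \<eta> (g z) \<partial>M) - \<epsilon> * (\<integral>z. r z \<partial>M) \<le>
        (\<Sum>i<n. (\<integral>z. cell k i z * r z \<partial>M) *
          \<eta> ((\<integral>z. cell k i z * (r z * g z) \<partial>M) / (\<integral>z. cell k i z * r z \<partial>M)))"
      by (rule coarse_graining_loss[where b = B and \<delta> = "\<delta> / 2"])
        (fact k(1,2) rint rnn rgint r\<eta>int gB osc \<eta>')+
    moreover have "(\<Sum>i<n. W x \<bullet> T i * ln (W x \<bullet> T i / Re (trace (T i)))) =
        (\<Sum>i<n. Re (trace (T i)) * \<eta> (W x \<bullet> T i / Re (trace (T i))))"
      using T0 by (intro sum.cong) (auto simp: \<eta>_def)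
    ultimately show "(\<integral>z. W x \<bullet> Q z * ln (W x \<bullet> Q z / Re (trace (Q z))) \<partial>M) - \<epsilon> * real CARD('d) \<le>
        (\<Sum>i<n. W x \<bullet> T i * ln (W x \<bullet> T i / Re (trace (T i))))"
      by (simp only: cr crg r1)
  qed
qed

section \<open>Lower bounds\<close>

context sic
begin

text \<open>Rescaled to trace \<open>d\<close>, so that \<open>weight x \<bullet> T / Tr T\<close>
  is the likelihood ratio \<open>p(x,y) / (p(x) p(y))\<close> in both problems:
  \<open>weight x\<close> is \<open>d^3\<close> times a SIC state or \<open>d^2\<close> times a SIC
  effect.\<close>

definition weight :: "real \<Rightarrow> complex^'d^'d" where
  "weight x = (real CARD('d) / l) *\<^sub>R X x"

lemma weight_outer:
  assumes "x \<in> sic_index CARD('d)"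
  obtains v where "norm v = 1" "weight x = real CARD('d) *\<^sub>R outer v"
proof -
  let ?v = "(1 / sqrt l) *\<^sub>R ket x"
  have "norm (ket x) = sqrt l"
    using ket(2)[OF assms] by (metis norm_ge_zero real_sqrt_unique)
  then have "norm ?v = 1"
    using pos by simp
  moreover have "outer ?v = (1 / l) *\<^sub>R outer (ket x)"
    using pos by (simp add: outer_def vec_eq_iff scaleR_conv_of_real[where 'a = complex] field_simps flip: of_real_mult)
  then have "weight x = real CARD('d) *\<^sub>R outer ?v"
    by (simp add: weight_def ket(1)[OF assms])
  ultimately show ?thesis
    using that by blast
qed

text \<open>For a single \<open>x\<close> the expectation of
  \<open>weight x \<bullet> outer z * ln ((norm z)^2)\<close> is left unevaluated. Only the sum over
  \<open>x\<close> is computed, where completeness makes the integrand radial. The total weight is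
  \<open>d^2 Tr 1 = d^3\<close>, whence the normalisation.\<close>

lemma exists_informative_povm:
  assumes "\<epsilon> > 0"
  obtains n :: nat and T :: "nat \<Rightarrow> complex^'d^'d" where
    "\<And>i. psd (T i)" "(\<Sum>i<n. T i) = mat 1"
    "ln (real CARD('d)) - (\<Sum>n = 2..CARD('d). 1 / real n) - \<epsilon> \<le>
      (\<Sum>x\<in>sic_index CARD('d). \<Sum>i<n. weight x \<bullet> T i * ln (weight x \<bullet> T i / Re (trace (T i)))) / real CARD('d) ^ 3"
proof -
  let ?I = "sic_index CARD('d)" and ?d = "real CARD('d)"
  let ?H = "\<Sum>n = 2..CARD('d). 1 / real n"
  have d: "?d > 0"
    by simp
  define L where "L z = ln ((norm z)\<^sup>2)" for z :: "complex^'d"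
  have nz: "AE z in gauss. z \<noteq> (0 :: complex^'d)"
    unfolding gauss_def using AE_lborel_singleton[of "0 :: complex^'d"]
    by (subst AE_density) (auto elim: eventually_mono)
  have iL: "integrable gauss (\<lambda>z :: complex^'d. (norm z)\<^sup>2 * L z)"
    unfolding L_def by (rule gauss_norm_square)
  have [measurable]: "L \<in> borel_measurable borel"
    unfolding L_def[abs_def] by measurable
  have val: "integrable gauss (\<lambda>z. weight x \<bullet> outer z * L z)"
    "(\<integral>z. weight x \<bullet> outer z * ln (weight x \<bullet> outer z / Re (trace (outer z))) \<partial>gauss) =
      ?d * (ln ?d + log_gamma_integral 1) - (\<integral>z. weight x \<bullet> outer z * L z \<partial>gauss)" if x: "x \<in> ?I" for x
  proof -
    obtain v where v: "norm v = 1" and w: "weight x = ?d *\<^sub>R outer v"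
      by (rule weight_outer[OF x])
    define s where "s z = (cmod (cdot v z))\<^sup>2" for z
    have wz: "weight x \<bullet> outer z = ?d * s z" for z
      by (simp add: w inner_outer s_def)
    have [measurable]: "s \<in> borel_measurable borel"
      unfolding s_def[abs_def] by measurable
    note G = gauss_cdot[OF v, folded s_def]
    \<comment> \<open>Cauchy-Schwarz for the outer products; it lets the integrable radial function
      dominate \<open>s z * L z\<close>.\<close>
    have sle: "s z \<le> (norm z)\<^sup>2" for z
    proof -
      have "s z \<le> norm (outer v) * norm (outer z)"
        unfolding s_def inner_outer[symmetric] by (rule norm_cauchy_schwarz)
      also have "\<dots> \<le> 1 * (norm z)\<^sup>2"
        using norm_outer_le[of v] norm_outer_le[of z] v by (intro mult_mono) auto
      finally show ?thesis by simp
    qed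
    have isL: "integrable gauss (\<lambda>z. s z * L z)"
    proof (rule Bochner_Integration.integrable_bound[OF iL])
      have "norm (s z * L z) \<le> norm ((norm z)\<^sup>2 * L z)" for z
        using sle[of z] by (simp add: abs_mult s_def mult_right_mono)
      then show "AE z in gauss. norm (s z * L z) \<le> norm ((norm z)\<^sup>2 * L z)"
        by simp
    qed measurable
    then show "integrable gauss (\<lambda>z. weight x \<bullet> outer z * L z)"
      by (simp add: wz mult.assoc)
    have "(\<integral>z. weight x \<bullet> outer z * ln (weight x \<bullet> outer z / Re (trace (outer z))) \<partial>gauss) =
        (\<integral>z. ?d * (ln ?d * s z + s z * ln (s z) - s z * L z) \<partial>gauss)"
    proof (rule integral_cong_AE)
      show "AE z in gauss. weight x \<bullet> outer z * ln (weight x \<bullet> outer z / Re (trace (outer z))) =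
          ?d * (ln ?d * s z + s z * ln (s z) - s z * L z)"
        using nz
      proof eventually_elim
        fix z :: "complex^'d" assume z: "z \<noteq> 0"
        have tr: "Re (trace (outer z)) = (norm z)\<^sup>2"
          by (simp add: trace_outer del: of_real_power)
        show "weight x \<bullet> outer z * ln (weight x \<bullet> outer z / Re (trace (outer z))) =
          ?d * (ln ?d * s z + s z * ln (s z) - s z * L z)"
        proof (cases "s z = 0")
          case False
          then have "s z > 0"
            by (simp add: s_def)
          then have "ln (?d * s z / (norm z)\<^sup>2) = ln ?d + ln (s z) - L z"
            using z d unfolding L_def by (subst ln_div) (auto simp: ln_mult)
          then show ?thesis
            by (simp only: wz tr) (simp only: algebra_simps)
        qed (simp add: wz)
      qed
    qed (simp_all add: wz trace_outer)
    also have "\<dots> = ?d * (ln ?d * 1 + log_gamma_integral 1 - (\<integral>z. s z * L z \<partial>gauss))"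
      using G isL by simp
    also have "\<dots> = ?d * (ln ?d + log_gamma_integral 1) - (\<integral>z. weight x \<bullet> outer z * L z \<partial>gauss)"
      by (simp add: wz mult.assoc right_diff_distrib)
    finally show "(\<integral>z. weight x \<bullet> outer z * ln (weight x \<bullet> outer z / Re (trace (outer z))) \<partial>gauss) =
        ?d * (ln ?d + log_gamma_integral 1) - (\<integral>z. weight x \<bullet> outer z * L z \<partial>gauss)" .
  qed
  have sumw: "(\<Sum>x\<in>?I. weight x) = ?d\<^sup>2 *\<^sub>R mat 1"
    using sum_eq pos by (simp add: weight_def power2_eq_square flip: scaleR_sum_right)
  \<comment> \<open>The \<open>d^2\<close> weights sum to \<open>d^2\<close> times the identity, so
    only \<open>Tr (outer z) = (norm z)^2\<close> survives.\<close>
  have "(\<Sum>x\<in>?I. \<integral>z. weight x \<bullet> outer z * L z \<partial>gauss) = (\<integral>z. (\<Sum>x\<in>?I. weight x \<bullet> outer z * L z) \<partial>gauss)"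
    using val(1) by (simp add: Bochner_Integration.integral_sum)
  also have "\<dots> = (\<integral>z. ?d\<^sup>2 * ((norm z)\<^sup>2 * L z) \<partial>gauss)"
    by (simp add: sumw trace_outer inner_commute[of "mat 1"] inner_mat_1 mult.assoc
        flip: sum_distrib_right inner_sum_left del: of_real_power)
  also have "\<dots> = ?d ^ 3 * (log_gamma_integral CARD('d) / fact CARD('d))"
    using gauss_norm_square(3)[where 'd = 'd] by (simp add: L_def power2_eq_square power3_eq_cube)
  also have "log_gamma_integral CARD('d) / fact CARD('d) = log_gamma_integral 1 + ?H"
    using log_gamma_integral_harmonic[of "CARD('d) - 1"] by simp
  finally have sumL: "(\<Sum>x\<in>?I. \<integral>z. weight x \<bullet> outer z * L z \<partial>gauss) = ?d ^ 3 * (log_gamma_integral 1 + ?H)" .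
  have wnorm: "norm (weight x) \<le> ?d" if x: "x \<in> ?I" for x
  proof -
    obtain v where v: "norm v = 1" and w: "weight x = ?d *\<^sub>R outer v"
      by (rule weight_outer[OF x])
    show ?thesis
      using norm_outer_le[of v] v by (simp add: w)
  qed
  have wnn: "0 \<le> weight x \<bullet> B" if "x \<in> ?I" "psd B" for x B
    using inner_psd_nonneg[OF that] pos by (simp add: weight_def)
  obtain n :: nat and T where T: "\<And>i. psd (T i)" "(\<Sum>i<n. T i) = mat 1" and
    le: "\<And>x. x \<in> ?I \<Longrightarrow>
      (\<integral>z. weight x \<bullet> outer z * ln (weight x \<bullet> outer z / Re (trace (outer z))) \<partial>gauss) - \<epsilon> * ?d \<le>
      (\<Sum>i<n. weight x \<bullet> T i * ln (weight x \<bullet> T i / Re (trace (T i))))"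
  proof (rule finite_povm_approximation[OF gauss_outer psd_outer, of ?I weight ?d \<epsilon>])
    show "norm (weight x) \<le> ?d" if "x \<in> ?I" for x
      by (rule wnorm[OF that])
    show "0 \<le> weight x \<bullet> B" if "x \<in> ?I" "psd B" for x B
      by (rule wnn[OF that])
    show "\<epsilon> > 0"
      by (rule assms)
    fix n' :: nat and T'
    assume "\<And>i. psd (T' i)" "(\<Sum>i<n'. T' i) = mat 1" and "\<And>x. x \<in> ?I \<Longrightarrow>
      (\<integral>z. weight x \<bullet> outer z * ln (weight x \<bullet> outer z / Re (trace (outer z))) \<partial>gauss) - \<epsilon> * ?d \<le>
      (\<Sum>i<n'. weight x \<bullet> T' i * ln (weight x \<bullet> T' i / Re (trace (T' i))))"
    then show thesis
      by (rule that)
  qed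
  show ?thesis
  proof (rule that[OF T])
    \<comment> \<open>The loss is \<open>\<epsilon> * d\<close> for each of \<open>d^2\<close>
      letters. The multiples of \<open>log_gamma_integral 1\<close> in the two parts cancel
      here.\<close>
    have "?d ^ 3 * (ln ?d - ?H - \<epsilon>) =
        (\<Sum>x\<in>?I. ?d * (ln ?d + log_gamma_integral 1) - (\<integral>z. weight x \<bullet> outer z * L z \<partial>gauss) - \<epsilon> * ?d)"
      unfolding sum_subtractf sumL sum_constant card_sic_index
      by (simp add: power2_eq_square power3_eq_cube algebra_simps)
    also have "\<dots> \<le> (\<Sum>x\<in>?I. \<Sum>i<n. weight x \<bullet> T i * ln (weight x \<bullet> T i / Re (trace (T i))))"
    proof (rule sum_mono)
      fix x assume x: "x \<in> ?I"
      show "?d * (ln ?d + log_gamma_integral 1) - (\<integral>z. weight x \<bullet> outer z * L z \<partial>gauss) - \<epsilon> * ?d \<le>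
          (\<Sum>i<n. weight x \<bullet> T i * ln (weight x \<bullet> T i / Re (trace (T i))))"
        using le[OF x] unfolding val(2)[OF x] .
    qed
    finally show "ln ?d - ?H - \<epsilon> \<le>
        (\<Sum>x\<in>?I. \<Sum>i<n. weight x \<bullet> T i * ln (weight x \<bullet> T i / Re (trace (T i)))) / ?d ^ 3"
      using d by (subst pos_le_divide_eq) (simp_all only: zero_less_power mult.commute)
  qed
qed

end

section \<open>From finite operator families to mutual information\<close>

lemma mutual_info_finite:
  assumes "finite A" "finite B"
  shows "mutual_info (count_space A) \<rho> (count_space B) P =
    (\<Sum>x\<in>A. \<Sum>y\<in>B. p_joint \<rho> P x y *
      log 2 (p_joint \<rho> P x y / (p_input \<rho> x * p_outcome (count_space A) \<rho> P y)))"
  using assms unfolding mutual_info_def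
  by (simp add: pair_measure_count_space lebesgue_integral_count_space_finite sum.cartesian_product)

lemma nat_index:
  fixes n :: nat
  shows "countable (real ` {..<n})" "finite (real ` {..<n})"
    "(\<Sum>y\<in>real ` {..<n}. f y) = (\<Sum>i<n. f (real i))"
  by (auto simp: sum.reindex countable_finite)

lemma index_measure_nat: "index_measure (count_space (real ` {..<n}))" for n :: nat
  unfolding index_measure_def using nat_index(1) by blast

lemma accessible_information_sic_ge:
  fixes \<rho> :: "real \<Rightarrow> complex^'d^'d"
  assumes "is_sic_ensemble \<rho>" "\<epsilon> > 0"
  shows "\<exists>\<nu> P. is_povm \<nu> P \<and> (ln (real CARD('d)) - (\<Sum>n = 2..CARD('d). 1 / real n) - \<epsilon>) / ln 2 \<le>
    mutual_info (count_space (sic_index CARD('d))) \<rho> \<nu> P"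
proof -
  let ?d = "real CARD('d)" and ?I = "sic_index CARD('d)"
  interpret sic "1 / ?d\<^sup>2" \<rho>
    using assms(1) by unfold_locales (auto simp: is_sic_ensemble_def)
  obtain n :: nat and T :: "nat \<Rightarrow> complex^'d^'d" where T: "\<And>i. psd (T i)" "(\<Sum>i<n. T i) = mat 1"
    and info: "ln ?d - (\<Sum>n = 2..CARD('d). 1 / real n) - \<epsilon> \<le>
      (\<Sum>x\<in>?I. \<Sum>i<n. weight x \<bullet> T i * ln (weight x \<bullet> T i / Re (trace (T i)))) / ?d ^ 3"
    by (rule exists_informative_povm[OF assms(2)]) blast
  let ?B = "real ` {..<n}"
  \<comment> \<open>Indices are real numbers, so the position in the list is decoded by
    \<open>nat\<close> and floor.\<close>
  define P where "P y = T (nat \<lfloor>y\<rfloor>)" for y :: real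
  have P: "P (real i) = T i" for i
    by (simp add: P_def)
  have "psd (mat 1 - T i)" if "i < n" for i
  proof -
    \<comment> \<open>The complement of an element is the sum of the others, which bounds each
      element by the identity.\<close>
    have "mat 1 - T i = (\<Sum>j\<in>{..<n} - {i}. T j)"
      using that by (simp add: T(2)[symmetric] sum_diff1)
    then show ?thesis
      using T(1) by (simp add: psd_sum)
  qed
  then have ex: "is_povm (count_space ?B) P"
    unfolding is_povm_def is_effect_def using T index_measure_nat[of n]
    by (auto simp: P has_bochner_integral_iff integrable_count_space lebesgue_integral_count_space_finite nat_index(3))
  have mi: "mutual_info (count_space ?I) \<rho> (count_space ?B) P =
      (\<Sum>x\<in>?I. \<Sum>i<n. weight x \<bullet> T i * ln (weight x \<bullet> T i / Re (trace (T i)))) / ?d ^ 3 / ln 2"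
  proof -
    have summand: "p_joint \<rho> P x (real i) * log 2 (p_joint \<rho> P x (real i) / (p_input \<rho> x * p_outcome (count_space ?I) \<rho> P (real i))) =
        weight x \<bullet> T i * ln (weight x \<bullet> T i / Re (trace (T i))) / (?d ^ 3 * ln 2)" if x: "x \<in> ?I" for x i
    proof -
      have "weight x = ?d ^ 3 *\<^sub>R \<rho> x"
        unfolding weight_def by (simp add: power2_eq_square power3_eq_cube)
      then have j: "p_joint \<rho> P x (real i) = weight x \<bullet> T i / ?d ^ 3"
        using Re_trace_mult[OF psd_hermitian[OF T(1)[of i]]] by (simp add: p_joint_def P)
      have q: "p_input \<rho> x = 1 / ?d\<^sup>2"
        using trace[OF x] by (simp add: p_input_def)
      have "average_state (count_space ?I) \<rho> = (1 / ?d) *\<^sub>R mat 1"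
        using sum_eq by (simp add: average_state_def lebesgue_integral_count_space_finite finite_sic_index power2_eq_square)
      then have r: "p_outcome (count_space ?I) \<rho> P (real i) = Re (trace (T i)) / ?d"
        using Re_trace_mult[OF psd_hermitian[OF T(1)[of i]], of "(1 / ?d) *\<^sub>R mat 1"]
        by (simp add: p_outcome_def P inner_commute[of "mat 1"] inner_mat_1)
      \<comment> \<open>All powers of \<open>d\<close> cancel in the likelihood ratio; for trace 0
        both sides are 0 by the convention on division.\<close>
      have "weight x \<bullet> T i / ?d ^ 3 / (1 / ?d\<^sup>2 * (Re (trace (T i)) / ?d)) = weight x \<bullet> T i / Re (trace (T i))"
        by (simp add: power2_eq_square power3_eq_cube)
      then show ?thesis
        unfolding j q r by (simp add: log_def)
    qed
    have "mutual_info (count_space ?I) \<rho> (count_space ?B) P =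
        (\<Sum>x\<in>?I. \<Sum>i<n. weight x \<bullet> T i * ln (weight x \<bullet> T i / Re (trace (T i))) / (?d ^ 3 * ln 2))"
      unfolding mutual_info_finite[OF finite_sic_index nat_index(2)] nat_index(3)
      by (rule sum.cong[OF refl], rule sum.cong[OF refl], rule summand, assumption)
    then show ?thesis
      by (simp only: sum_divide_distrib divide_divide_eq_left)
  qed
  show ?thesis
  proof (intro exI conjI)
    show "(ln ?d - (\<Sum>n = 2..CARD('d). 1 / real n) - \<epsilon>) / ln 2 \<le> mutual_info (count_space ?I) \<rho> (count_space ?B) P"
      unfolding mi using info by (rule divide_right_mono) simp
  qed (rule ex)
qed

text \<open>The same finite POVM divided by \<open>d\<close> is an ensemble with maximally mixed
  average state, which makes the SIC outcomes uniform. The summands then coincide with those for the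
  accessible information.\<close>

lemma informational_power_sic_ge:
  fixes P :: "real \<Rightarrow> complex^'d^'d"
  assumes "is_sic_povm P" "\<epsilon> > 0"
  shows "\<exists>\<mu> \<rho>. is_ensemble \<mu> \<rho> \<and> (ln (real CARD('d)) - (\<Sum>n = 2..CARD('d). 1 / real n) - \<epsilon>) / ln 2 \<le>
    mutual_info \<mu> \<rho> (count_space (sic_index CARD('d))) P"
proof -
  let ?d = "real CARD('d)" and ?I = "sic_index CARD('d)"
  interpret sic "1 / ?d" P
    using assms(1) by unfold_locales (auto simp: is_sic_povm_def)
  obtain n :: nat and T :: "nat \<Rightarrow> complex^'d^'d" where T: "\<And>i. psd (T i)" "(\<Sum>i<n. T i) = mat 1"
    and info: "ln ?d - (\<Sum>n = 2..CARD('d). 1 / real n) - \<epsilon> \<le>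
      (\<Sum>x\<in>?I. \<Sum>i<n. weight x \<bullet> T i * ln (weight x \<bullet> T i / Re (trace (T i)))) / ?d ^ 3"
    by (rule exists_informative_povm[OF assms(2)]) blast
  let ?B = "real ` {..<n}"
  define \<rho> where "\<rho> y = (1 / ?d) *\<^sub>R T (nat \<lfloor>y\<rfloor>)" for y :: real
  have \<rho>: "\<rho> (real i) = (1 / ?d) *\<^sub>R T i" for i
    by (simp add: \<rho>_def)
  have tr\<rho>: "Re (trace (\<rho> (real i))) = Re (trace (T i)) / ?d" for i
    by (simp add: \<rho> flip: inner_mat_1)
  have psd\<rho>: "psd (\<rho> (real i))" for i
    unfolding \<rho> using T(1) by (intro psd_scaleR) auto
  have trT: "(\<Sum>i<n. Re (trace (T i))) = ?d"
    by (simp only: inner_mat_1[symmetric] inner_sum_left[symmetric] T(2) mat_1_inner_self)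
  \<comment> \<open>The traces are nonnegative with total \<open>?d\<close>, so after division by
    \<open>?d\<close> each is at most 1.\<close>
  have "Re (trace (T i)) \<le> ?d" if "i < n" for i
    unfolding trT[symmetric] using that psd_trace_nonneg[OF T(1)] by (intro member_le_sum) auto
  then have ex: "is_ensemble (count_space ?B) \<rho>"
    unfolding is_ensemble_def is_state_def using T index_measure_nat[of n] trT
    by (auto simp: tr\<rho> has_bochner_integral_iff integrable_count_space lebesgue_integral_count_space_finite nat_index(3)
        psd\<rho> simp flip: sum_divide_distrib)
  have mi: "mutual_info (count_space ?B) \<rho> (count_space ?I) P =
      (\<Sum>x\<in>?I. \<Sum>i<n. weight x \<bullet> T i * ln (weight x \<bullet> T i / Re (trace (T i)))) / ?d ^ 3 / ln 2"
  proof -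
    have summand: "p_joint \<rho> P (real i) x * log 2 (p_joint \<rho> P (real i) x / (p_input \<rho> (real i) * p_outcome (count_space ?B) \<rho> P x)) =
        weight x \<bullet> T i * ln (weight x \<bullet> T i / Re (trace (T i))) / (?d ^ 3 * ln 2)" if x: "x \<in> ?I" for x i
    proof -
      note tm = Re_trace_mult[OF psd_hermitian[OF psd[OF x]]]
      have "weight x = ?d\<^sup>2 *\<^sub>R P x"
        unfolding weight_def by (simp add: power2_eq_square)
      then have j: "p_joint \<rho> P (real i) x = weight x \<bullet> T i / ?d ^ 3"
        by (simp add: p_joint_def tm \<rho> power2_eq_square power3_eq_cube inner_commute)
      have q: "p_input \<rho> (real i) = Re (trace (T i)) / ?d"
        by (simp add: p_input_def tr\<rho>)
      have "average_state (count_space ?B) \<rho> = (1 / ?d) *\<^sub>R mat 1"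
        by (simp add: average_state_def lebesgue_integral_count_space_finite nat_index(2,3) \<rho> T(2) flip: scaleR_sum_right)
      then have r: "p_outcome (count_space ?B) \<rho> P x = 1 / ?d\<^sup>2"
        using inner_one[OF x] by (simp add: p_outcome_def tm inner_commute[of "mat 1"] power2_eq_square)
      have "weight x \<bullet> T i / ?d ^ 3 / (Re (trace (T i)) / ?d * (1 / ?d\<^sup>2)) = weight x \<bullet> T i / Re (trace (T i))"
        by (simp add: power2_eq_square power3_eq_cube)
      then show ?thesis
        unfolding j q r by (simp add: log_def)
    qed
    have "mutual_info (count_space ?B) \<rho> (count_space ?I) P =
        (\<Sum>i<n. \<Sum>x\<in>?I. weight x \<bullet> T i * ln (weight x \<bullet> T i / Re (trace (T i))) / (?d ^ 3 * ln 2))"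
      unfolding mutual_info_finite[OF nat_index(2) finite_sic_index] nat_index(3)
      by (rule sum.cong[OF refl], rule sum.cong[OF refl], rule summand, assumption)
    then show ?thesis
      by (subst (asm) sum.swap) (simp only: sum_divide_distrib divide_divide_eq_left)
  qed
  show ?thesis
  proof (intro exI conjI)
    show "(ln ?d - (\<Sum>n = 2..CARD('d). 1 / real n) - \<epsilon>) / ln 2 \<le> mutual_info (count_space ?B) \<rho> (count_space ?I) P"
      unfolding mi using info by (rule divide_right_mono) simp
  qed (rule ex)
qed

lemma ereal_le_if_approx:
  fixes S :: ereal
  assumes "\<And>\<epsilon>. \<epsilon> > 0 \<Longrightarrow> ereal ((a - \<epsilon>) / ln 2) \<le> S"
  shows "ereal (a / ln 2) \<le> S"
proof (rule ereal_le_epsilon2)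
  fix e :: real assume e: "e > 0"
  \<comment> \<open>The factor \<open>ln 2\<close> converts an error of \<open>e\<close> bits into
    the natural units of the hypothesis.\<close>
  have "ereal ((a - e * ln 2) / ln 2) \<le> S"
    using e by (intro assms) simp
  then have "ereal (a / ln 2 - e) \<le> S"
    by (simp add: diff_divide_distrib)
  then show "ereal (a / ln 2) \<le> S + ereal e"
    by (cases S) auto
qed

theorem theorem2:
  fixes \<rho> P :: "real \<Rightarrow> complex^'d^'d"
  assumes "is_sic_ensemble \<rho>" and "is_sic_povm P"
  shows "ereal (log 2 (real CARD('d)) - 1 / ln 2 * (\<Sum>n = 2..CARD('d). 1 / real n))
           \<le> accessible_information (count_space (sic_index CARD('d))) \<rho> \<and>
         accessible_information (count_space (sic_index CARD('d))) \<rho>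
           \<le> ereal (log 2 (2 * real CARD('d) / (real CARD('d) + 1))) \<and>
         ereal (log 2 (real CARD('d)) - 1 / ln 2 * (\<Sum>n = 2..CARD('d). 1 / real n))
           \<le> informational_power (count_space (sic_index CARD('d))) P \<and>
         informational_power (count_space (sic_index CARD('d))) P
           \<le> ereal (log 2 (2 * real CARD('d) / (real CARD('d) + 1)))"
proof -
  let ?\<mu> = "count_space (sic_index CARD('d))"
  let ?a = "ln (real CARD('d)) - (\<Sum>n = 2..CARD('d). 1 / real n)"
  have a: "log 2 (real CARD('d)) - 1 / ln 2 * (\<Sum>n = 2..CARD('d). 1 / real n) = ?a / ln 2"
    by (simp add: log_def diff_divide_distrib)
  have "ereal (?a / ln 2) \<le> accessible_information ?\<mu> \<rho>"
  proof (rule ereal_le_if_approx)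
    fix \<epsilon> :: real assume "\<epsilon> > 0"
    then obtain \<nu> P where *: "is_povm \<nu> P" "(?a - \<epsilon>) / ln 2 \<le> mutual_info ?\<mu> \<rho> \<nu> P"
      using accessible_information_sic_ge[OF assms(1)] by blast
    show "ereal ((?a - \<epsilon>) / ln 2) \<le> accessible_information ?\<mu> \<rho>"
      unfolding accessible_information_def using * by (intro SUP_upper2[of "(\<nu>, P)"]) auto
  qed
  moreover have "ereal (?a / ln 2) \<le> informational_power ?\<mu> P"
  proof (rule ereal_le_if_approx)
    fix \<epsilon> :: real assume "\<epsilon> > 0"
    then obtain \<mu> \<rho> where *: "is_ensemble \<mu> \<rho>" "(?a - \<epsilon>) / ln 2 \<le> mutual_info \<mu> \<rho> ?\<mu> P"
      using informational_power_sic_ge[OF assms(2)] by blast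
    show "ereal ((?a - \<epsilon>) / ln 2) \<le> informational_power ?\<mu> P"
      unfolding informational_power_def using * by (intro SUP_upper2[of "(\<mu>, \<rho>)"]) auto
  qed
  moreover have "accessible_information ?\<mu> \<rho> \<le> ereal (log 2 (2 * real CARD('d) / (real CARD('d) + 1)))"
    unfolding accessible_information_def using mutual_info_sic_ensemble_le[OF assms(1)] by (intro SUP_least) auto
  moreover have "informational_power ?\<mu> P \<le> ereal (log 2 (2 * real CARD('d) / (real CARD('d) + 1)))"
    unfolding informational_power_def using mutual_info_sic_povm_le[OF assms(2)] by (intro SUP_least) auto
  ultimately show ?thesis
    unfolding a by blast
qed

end
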